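(* Let $(H,\mathcal{R})$ be a quasi-triangular Hopf algebra over $K$ with R-matrix $\mathcal{R}=\sum_i s_i\otimes t_i\in H\otimes H$, and let $(A,m)$ be a (left) module-algebra over $H$. Let $\sigma_A: A\otimes A\to A\otimes A$ be given by $\sigma_A(a\otimes b)=\sum_i t_i\cdot b\otimes s_i\cdot a$. Then $(A,m,\sigma_A)$ is a braided algebra.
   Context: $K$ is a field of characteristic $0$. Algebras are associative and unital. Quasi-triangular: $\mathcal{R}$ is invertible, $\Delta^{op}(h)\mathcal{R}=\mathcal{R}\Delta(h)$ for all $h\in H$, $(\Delta\otimes\mathrm{id})(\mathcal{R})=\mathcal{R}_{13}\mathcal{R}_{23}$ and $(\mathrm{id}\otimes\Delta)(\mathcal{R})=\mathcal{R}_{13}\mathcal{R}_{12}$. An algebra $A$ is a module-algebra over $H$ if $A$ is a left $H$-module with $h\cdot(ab)=\sum (h_{(1)}\cdot a)(h_{(2)}\cdot b)$ and $h\cdot 1_A=\varepsilon(h)1_A$. (The map $\sigma_A$ is the braiding $c_{A,A}(a\otimes b)=\sum a_{(-1)}\cdot b\otimes a_{(0)}$ of the Yetter-Drinfel'd module $A$ with coaction $\rho(a)=\sum_i t_i\otimes s_i\cdot a$.) A braiding on a vector space $V$ is an invertible linear map $\sigma\in\mathrm{End}(V\otimes V)$ with $\sigma_1\sigma_2\sigma_1=\sigma_2\sigma_1\sigma_2$ on $V^{\otimes 3}$, where $\sigma_1=\sigma\otimes\mathrm{id}_V$, $\sigma_2=\mathrm{id}_V\otimes\sigma$. A braided algebra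 $(A,m,\sigma)$ is an algebra with product $m$ and unit $1_A$ together with a braiding $\sigma$ on $A$ such that $\sigma(m\otimes\mathrm{id}_A)=(\mathrm{id}_A\otimes m)\sigma_1\sigma_2$, $\sigma(\mathrm{id}_A\otimes m)=(m\otimes\mathrm{id}_A)\sigma_2\sigma_1$, $\sigma(1_A\otimes a)=a\otimes 1_A$ and $\sigma(a\otimes 1_A)=1_A\otimes a$ for all $a\in A$. *)

theory Defs
  imports "HOL-Algebra.Module" "HOL-Algebra.RingHom"
begin

section \<open>Linear maps and algebras over a field\<close>

locale char0_field = field K for K (structure) +
  assumes char_zero: "0 < (n::nat) \<Longrightarrow> [n] \<cdot> \<one> \<noteq> \<zero>"

locale kvector_space = K?: field K + module K V for K (structure) and V (structure)

definition linear_maps ::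
  "('k, 'r) ring_scheme \<Rightarrow> ('k, 'v, 'm) module_scheme \<Rightarrow> ('k, 'w, 'n) module_scheme \<Rightarrow> ('v \<Rightarrow> 'w) set"
  where "linear_maps K V W =
    {f \<in> carrier V \<rightarrow> carrier W.
       (\<forall>x\<in>carrier V. \<forall>y\<in>carrier V. f (x \<oplus>\<^bsub>V\<^esub> y) = f x \<oplus>\<^bsub>W\<^esub> f y) \<and>
       (\<forall>c\<in>carrier K. \<forall>x\<in>carrier V. f (c \<odot>\<^bsub>V\<^esub> x) = c \<odot>\<^bsub>W\<^esub> f x)}"

definition bilinear_maps ::
  "('k, 'r) ring_scheme \<Rightarrow> ('k, 'v, 'm) module_scheme \<Rightarrow> ('k, 'w, 'n) module_scheme
    \<Rightarrow> ('k, 'x, 'l) module_scheme \<Rightarrow> ('v \<Rightarrow> 'w \<Rightarrow> 'x) set"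
  where "bilinear_maps K V W X =
    {\<beta>. (\<forall>v\<in>carrier V. \<beta> v \<in> linear_maps K W X) \<and>
        (\<forall>w\<in>carrier W. (\<lambda>v. \<beta> v w) \<in> linear_maps K V X)}"

text \<open>The library locale \<^locale>\<open>algebra\<close> is restricted to commutative algebras.\<close>

locale unital_algebra = K?: field K + module K A + A?: ring A for K (structure) and A (structure) +
  assumes smult_mult_left:
      "\<lbrakk>c \<in> carrier K; x \<in> carrier A; y \<in> carrier A\<rbrakk>
        \<Longrightarrow> (c \<odot>\<^bsub>A\<^esub> x) \<otimes>\<^bsub>A\<^esub> y = c \<odot>\<^bsub>A\<^esub> (x \<otimes>\<^bsub>A\<^esub> y)"
    and smult_mult_right:
      "\<lbrakk>c \<in> carrier K; x \<in> carrier A; y \<in> carrier A\<rbrakk>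
        \<Longrightarrow> x \<otimes>\<^bsub>A\<^esub> (c \<odot>\<^bsub>A\<^esub> y) = c \<odot>\<^bsub>A\<^esub> (x \<otimes>\<^bsub>A\<^esub> y)"


section \<open>Tensor products\<close>

text \<open>
  \<open>V \<otimes> W\<close> is the free module on \<open>V \<times> W\<close> modulo the submodule generated by the bilinearity relations.
  Its elements are cosets of finitely supported functions.
\<close>

definition free_module :: "('k, 'r) ring_scheme \<Rightarrow> 'b set \<Rightarrow> ('k, 'b \<Rightarrow> 'k) module"
  where "free_module K B =
    \<lparr>carrier = {f. range f \<subseteq> carrier K \<and> {b. f b \<noteq> \<zero>\<^bsub>K\<^esub>} \<subseteq> B \<and> finite {b. f b \<noteq> \<zero>\<^bsub>K\<^esub>}},
     mult = undefined, one = undefined,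
     zero = (\<lambda>b. \<zero>\<^bsub>K\<^esub>), add = (\<lambda>f g b. f b \<oplus>\<^bsub>K\<^esub> g b),
     smult = (\<lambda>c f b. c \<otimes>\<^bsub>K\<^esub> f b)\<rparr>"

definition free_gen :: "('k, 'r) ring_scheme \<Rightarrow> 'b \<Rightarrow> 'b \<Rightarrow> 'k"
  where "free_gen K b = (\<lambda>b'. if b' = b then \<one>\<^bsub>K\<^esub> else \<zero>\<^bsub>K\<^esub>)"

definition submodule_generated ::
  "('k, 'r) ring_scheme \<Rightarrow> ('k, 'v, 'm) module_scheme \<Rightarrow> 'v set \<Rightarrow> 'v set"
  where "submodule_generated K V G = \<Inter>{N. submodule N K V \<and> G \<subseteq> N}"

definition quotient_module :: "('k, 'v, 'm) module_scheme \<Rightarrow> 'v set \<Rightarrow> ('k, 'v set) module"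
  where "quotient_module V N =
    \<lparr>carrier = a_rcosets\<^bsub>V\<^esub> N, mult = undefined, one = undefined, zero = N, add = set_add V,
     smult = (\<lambda>c X. \<Union>x\<in>X. N +>\<^bsub>V\<^esub> (c \<odot>\<^bsub>V\<^esub> x))\<rparr>"

definition tensor_relations ::
  "('k, 'r) ring_scheme \<Rightarrow> ('k, 'v, 'm) module_scheme \<Rightarrow> ('k, 'w, 'n) module_scheme
    \<Rightarrow> ('v \<times> 'w \<Rightarrow> 'k) set"
  where "tensor_relations K V W =
    (let F = free_module K (carrier V \<times> carrier W); \<delta> = free_gen K in
      {\<delta> (v \<oplus>\<^bsub>V\<^esub> v', w) \<ominus>\<^bsub>F\<^esub> (\<delta> (v, w) \<oplus>\<^bsub>F\<^esub> \<delta> (v', w)) | v v' w.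
         v \<in> carrier V \<and> v' \<in> carrier V \<and> w \<in> carrier W} \<union>
      {\<delta> (v, w \<oplus>\<^bsub>W\<^esub> w') \<ominus>\<^bsub>F\<^esub> (\<delta> (v, w) \<oplus>\<^bsub>F\<^esub> \<delta> (v, w')) | v w w'.
         v \<in> carrier V \<and> w \<in> carrier W \<and> w' \<in> carrier W} \<union>
      {\<delta> (c \<odot>\<^bsub>V\<^esub> v, w) \<ominus>\<^bsub>F\<^esub> (c \<odot>\<^bsub>F\<^esub> \<delta> (v, w)) | c v w.
         c \<in> carrier K \<and> v \<in> carrier V \<and> w \<in> carrier W} \<union>
      {\<delta> (v, c \<odot>\<^bsub>W\<^esub> w) \<ominus>\<^bsub>F\<^esub> (c \<odot>\<^bsub>F\<^esub> \<delta> (v, w)) | c v w.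
         c \<in> carrier K \<and> v \<in> carrier V \<and> w \<in> carrier W})"

definition tensor_null ::
  "('k, 'r) ring_scheme \<Rightarrow> ('k, 'v, 'm) module_scheme \<Rightarrow> ('k, 'w, 'n) module_scheme
    \<Rightarrow> ('v \<times> 'w \<Rightarrow> 'k) set"
  where "tensor_null K V W =
    submodule_generated K (free_module K (carrier V \<times> carrier W)) (tensor_relations K V W)"

definition tensor_space ::
  "('k, 'r) ring_scheme \<Rightarrow> ('k, 'v, 'm) module_scheme \<Rightarrow> ('k, 'w, 'n) module_scheme
    \<Rightarrow> ('k, ('v \<times> 'w \<Rightarrow> 'k) set) module"
  where "tensor_space K V W =
    quotient_module (free_module K (carrier V \<times> carrier W)) (tensor_null K V W)"

definition pure_tensor ::
  "('k, 'r) ring_scheme \<Rightarrow> ('k, 'v, 'm) module_scheme \<Rightarrow> ('k, 'w, 'n) module_scheme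
    \<Rightarrow> 'v \<Rightarrow> 'w \<Rightarrow> ('v \<times> 'w \<Rightarrow> 'k) set"
  where "pure_tensor K V W v w =
    tensor_null K V W +>\<^bsub>free_module K (carrier V \<times> carrier W)\<^esub> free_gen K (v, w)"

text \<open>
  The linear extension \<open>v \<otimes> w \<mapsto> \<beta> v w\<close> of a bilinear map \<open>\<beta>\<close> into \<open>X\<close>: all representatives
  of a coset give the same value when \<open>\<beta>\<close> is bilinear; see \<open>tensor_lift_pure\<close>, \<open>tensor_lift_linear\<close> and
  \<open>tensor_induct\<close> at the end of this theory.
\<close>

definition tensor_lift ::
  "('k, 'r) ring_scheme \<Rightarrow> ('k, 'x, 'l) module_scheme \<Rightarrow> ('v \<Rightarrow> 'w \<Rightarrow> 'x)
    \<Rightarrow> ('v \<times> 'w \<Rightarrow> 'k) set \<Rightarrow> 'x"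
  where "tensor_lift K X \<beta> t =
    the_elem ((\<lambda>f. \<Oplus>\<^bsub>X\<^esub>p\<in>{p. f p \<noteq> \<zero>\<^bsub>K\<^esub>}. f p \<odot>\<^bsub>X\<^esub> \<beta> (fst p) (snd p)) ` t)"

text \<open>
  The product \<open>(a \<otimes> b)(c \<otimes> d) = ac \<otimes> bd\<close> and unit \<open>1 \<otimes> 1\<close> are
  meaningful only if both factors are algebras; for plain vector spaces they are to be ignored.
\<close>

definition tensor ::
  "('k, 'r) ring_scheme \<Rightarrow> ('k, 'v, 'm) module_scheme \<Rightarrow> ('k, 'w, 'n) module_scheme
    \<Rightarrow> ('k, ('v \<times> 'w \<Rightarrow> 'k) set) module"
  where "tensor K V W = (tensor_space K V W)
    \<lparr>mult := (\<lambda>x y. tensor_lift K (tensor_space K V W)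
       (\<lambda>a b. tensor_lift K (tensor_space K V W)
          (\<lambda>c d. pure_tensor K V W (a \<otimes>\<^bsub>V\<^esub> c) (b \<otimes>\<^bsub>W\<^esub> d)) y) x),
     one := pure_tensor K V W \<one>\<^bsub>V\<^esub> \<one>\<^bsub>W\<^esub>\<rparr>"

text \<open>\<open>f \<otimes> g\<close> for linear maps \<open>f\<close> into \<open>V\<close> and \<open>g\<close> into \<open>W\<close>.\<close>

definition tensor_map ::
  "('k, 'r) ring_scheme \<Rightarrow> ('k, 'v, 'm) module_scheme \<Rightarrow> ('k, 'w, 'n) module_scheme
    \<Rightarrow> ('a \<Rightarrow> 'v) \<Rightarrow> ('b \<Rightarrow> 'w) \<Rightarrow> ('a \<times> 'b \<Rightarrow> 'k) set \<Rightarrow> ('v \<times> 'w \<Rightarrow> 'k) set"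
  where "tensor_map K V W f g =
    tensor_lift K (tensor K V W) (\<lambda>a b. pure_tensor K V W (f a) (g b))"

definition tensor_flip ::
  "('k, 'r) ring_scheme \<Rightarrow> ('k, 'v, 'm) module_scheme \<Rightarrow> ('k, 'w, 'n) module_scheme
    \<Rightarrow> ('v \<times> 'w \<Rightarrow> 'k) set \<Rightarrow> ('w \<times> 'v \<Rightarrow> 'k) set"
  where "tensor_flip K V W = tensor_lift K (tensor K W V) (\<lambda>v w. pure_tensor K W V w v)"

text \<open>The canonical isomorphism \<open>(U \<otimes> V) \<otimes> W \<cong> U \<otimes> (V \<otimes> W)\<close> and its inverse.\<close>

definition tensor_assoc ::
  "('k, 'r) ring_scheme \<Rightarrow> ('k, 'u, 'l) module_scheme \<Rightarrow> ('k, 'v, 'm) module_scheme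
    \<Rightarrow> ('k, 'w, 'n) module_scheme
    \<Rightarrow> (('u \<times> 'v \<Rightarrow> 'k) set \<times> 'w \<Rightarrow> 'k) set \<Rightarrow> ('u \<times> ('v \<times> 'w \<Rightarrow> 'k) set \<Rightarrow> 'k) set"
  where "tensor_assoc K U V W =
    tensor_lift K (tensor K U (tensor K V W)) (\<lambda>x w. tensor_lift K (tensor K U (tensor K V W))
      (\<lambda>u v. pure_tensor K U (tensor K V W) u (pure_tensor K V W v w)) x)"

definition tensor_assoc_inv ::
  "('k, 'r) ring_scheme \<Rightarrow> ('k, 'u, 'l) module_scheme \<Rightarrow> ('k, 'v, 'm) module_scheme
    \<Rightarrow> ('k, 'w, 'n) module_scheme
    \<Rightarrow> ('u \<times> ('v \<times> 'w \<Rightarrow> 'k) set \<Rightarrow> 'k) set \<Rightarrow> (('u \<times> 'v \<Rightarrow> 'k) set \<times> 'w \<Rightarrow> 'k) set"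
  where "tensor_assoc_inv K U V W =
    tensor_lift K (tensor K (tensor K U V) W) (\<lambda>u y. tensor_lift K (tensor K (tensor K U V) W)
      (\<lambda>v w. pure_tensor K (tensor K U V) W (pure_tensor K U V u v) w) y)"

text \<open>\<open>V\<^sup>\<otimes>\<^sup>3\<close> is read as \<open>(V \<otimes> V) \<otimes> V\<close> throughout.\<close>

abbreviation tensor3 ::
  "('k, 'r) ring_scheme \<Rightarrow> ('k, 'v, 'm) module_scheme
    \<Rightarrow> ('k, (('v \<times> 'v \<Rightarrow> 'k) set \<times> 'v \<Rightarrow> 'k) set) module"
  where "tensor3 K V \<equiv> tensor K (tensor K V V) V"

definition mult_map ::
  "('k, 'r) ring_scheme \<Rightarrow> ('k, 'a, 'm) module_scheme \<Rightarrow> ('a \<times> 'a \<Rightarrow> 'k) set \<Rightarrow> 'a"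
  where "mult_map K A = tensor_lift K A (mult A)"


section \<open>Quasi-triangular Hopf algebras and module-algebras\<close>

locale hopf_algebra = unital_algebra K H for K (structure) and H (structure) +
  fixes \<Delta> and \<epsilon> and S
  assumes comult_linear: "\<Delta> \<in> linear_maps K H (tensor K H H)"
    and counit_linear: "\<And>c x. \<lbrakk>c \<in> carrier K; x \<in> carrier H\<rbrakk> \<Longrightarrow> \<epsilon> (c \<odot>\<^bsub>H\<^esub> x) = c \<otimes>\<^bsub>K\<^esub> \<epsilon> x"
    and antipode_linear: "S \<in> linear_maps K H H"
    and comult_hom: "\<Delta> \<in> ring_hom H (tensor K H H)"
    and counit_hom: "\<epsilon> \<in> ring_hom H K"
    and coassoc: "\<And>h. h \<in> carrier H \<Longrightarrow>
      tensor_assoc K H H H (tensor_map K (tensor K H H) H \<Delta> id (\<Delta> h))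
        = tensor_map K H (tensor K H H) id \<Delta> (\<Delta> h)"
    and counit_left: "\<And>h. h \<in> carrier H \<Longrightarrow> tensor_lift K H (\<lambda>x y. \<epsilon> x \<odot>\<^bsub>H\<^esub> y) (\<Delta> h) = h"
    and counit_right: "\<And>h. h \<in> carrier H \<Longrightarrow> tensor_lift K H (\<lambda>x y. \<epsilon> y \<odot>\<^bsub>H\<^esub> x) (\<Delta> h) = h"
    and antipode_left: "\<And>h. h \<in> carrier H \<Longrightarrow>
      tensor_lift K H (\<lambda>x y. S x \<otimes>\<^bsub>H\<^esub> y) (\<Delta> h) = \<epsilon> h \<odot>\<^bsub>H\<^esub> \<one>\<^bsub>H\<^esub>"
    and antipode_right: "\<And>h. h \<in> carrier H \<Longrightarrow>
      tensor_lift K H (\<lambda>x y. x \<otimes>\<^bsub>H\<^esub> S y) (\<Delta> h) = \<epsilon> h \<odot>\<^bsub>H\<^esub> \<one>\<^bsub>H\<^esub>"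

text \<open>\<open>R\<^sub>1\<^sub>2\<close>, \<open>R\<^sub>1\<^sub>3\<close>, \<open>R\<^sub>2\<^sub>3\<close> as elements of \<open>(H \<otimes> H) \<otimes> H\<close>.\<close>

definition leg12 where
  "leg12 K H R = tensor_lift K (tensor3 K H)
    (\<lambda>s t. pure_tensor K (tensor K H H) H (pure_tensor K H H s t) \<one>\<^bsub>H\<^esub>) R"

definition leg13 where
  "leg13 K H R = tensor_lift K (tensor3 K H)
    (\<lambda>s t. pure_tensor K (tensor K H H) H (pure_tensor K H H s \<one>\<^bsub>H\<^esub>) t) R"

definition leg23 where
  "leg23 K H R = tensor_lift K (tensor3 K H)
    (\<lambda>s t. pure_tensor K (tensor K H H) H (pure_tensor K H H \<one>\<^bsub>H\<^esub> s) t) R"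

locale quasi_triangular_hopf_algebra = hopf_algebra K H \<Delta> \<epsilon> S
  for K (structure) and H (structure) and \<Delta> \<epsilon> S +
  fixes R
  assumes R_invertible: "R \<in> Units (tensor K H H)"
    and R_opposite: "\<And>h. h \<in> carrier H \<Longrightarrow>
      tensor_flip K H H (\<Delta> h) \<otimes>\<^bsub>tensor K H H\<^esub> R = R \<otimes>\<^bsub>tensor K H H\<^esub> \<Delta> h"
    and R_comult_left:
      "tensor_map K (tensor K H H) H \<Delta> id R = leg13 K H R \<otimes>\<^bsub>tensor3 K H\<^esub> leg23 K H R"
    and R_comult_right:
      "tensor_map K H (tensor K H H) id \<Delta> R
        = tensor_assoc K H H H (leg13 K H R \<otimes>\<^bsub>tensor3 K H\<^esub> leg12 K H R)"

locale module_algebra = H?: hopf_algebra K H \<Delta> \<epsilon> S + A?: unital_algebra K A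
  for K (structure) and H (structure) and \<Delta> \<epsilon> S and A (structure) +
  fixes act (infixr \<open>\<rhd>\<close> 75)
  assumes act_bilinear: "act \<in> bilinear_maps K H A A"
    and act_one: "\<And>a. a \<in> carrier A \<Longrightarrow> \<one>\<^bsub>H\<^esub> \<rhd> a = a"
    and act_mult: "\<And>g h a. \<lbrakk>g \<in> carrier H; h \<in> carrier H; a \<in> carrier A\<rbrakk> \<Longrightarrow>
      (g \<otimes>\<^bsub>H\<^esub> h) \<rhd> a = g \<rhd> (h \<rhd> a)"
    and act_prod: "\<And>h a b. \<lbrakk>h \<in> carrier H; a \<in> carrier A; b \<in> carrier A\<rbrakk> \<Longrightarrow>
      h \<rhd> (a \<otimes>\<^bsub>A\<^esub> b) = tensor_lift K A (\<lambda>g g'. (g \<rhd> a) \<otimes>\<^bsub>A\<^esub> (g' \<rhd> b)) (\<Delta> h)"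
    and act_unit: "\<And>h. h \<in> carrier H \<Longrightarrow> h \<rhd> \<one>\<^bsub>A\<^esub> = \<epsilon> h \<odot>\<^bsub>A\<^esub> \<one>\<^bsub>A\<^esub>"


section \<open>Braidings and braided algebras\<close>

definition braid1 where
  "braid1 K V \<sigma> = tensor_map K (tensor K V V) V \<sigma> id"

definition braid2 where
  "braid2 K V \<sigma> =
    tensor_assoc_inv K V V V \<circ> tensor_map K V (tensor K V V) id \<sigma> \<circ> tensor_assoc K V V V"

locale braiding = kvector_space K V for K (structure) and V (structure) +
  fixes \<sigma>
  assumes braiding_linear: "\<sigma> \<in> linear_maps K (tensor K V V) (tensor K V V)"
    and braiding_bij: "bij_betw \<sigma> (carrier (tensor K V V)) (carrier (tensor K V V))"
    and yang_baxter: "\<And>x. x \<in> carrier (tensor3 K V) \<Longrightarrow>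
      braid1 K V \<sigma> (braid2 K V \<sigma> (braid1 K V \<sigma> x)) = braid2 K V \<sigma> (braid1 K V \<sigma> (braid2 K V \<sigma> x))"

locale braided_algebra = A?: unital_algebra K A + braiding K A \<sigma>
  for K (structure) and A (structure) and \<sigma> +
  assumes braiding_mult_left: "\<And>x. x \<in> carrier (tensor3 K A) \<Longrightarrow>
      \<sigma> (tensor_map K A A (mult_map K A) id x)
        = tensor_map K A A id (mult_map K A)
            (tensor_assoc K A A A (braid1 K A \<sigma> (braid2 K A \<sigma> x)))"
    and braiding_mult_right: "\<And>x. x \<in> carrier (tensor3 K A) \<Longrightarrow>
      \<sigma> (tensor_map K A A id (mult_map K A) (tensor_assoc K A A A x))
        = tensor_map K A A (mult_map K A) id (braid2 K A \<sigma> (braid1 K A \<sigma> x))"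
    and braiding_one_left: "\<And>a. a \<in> carrier A \<Longrightarrow>
      \<sigma> (pure_tensor K A A \<one>\<^bsub>A\<^esub> a) = pure_tensor K A A a \<one>\<^bsub>A\<^esub>"
    and braiding_one_right: "\<And>a. a \<in> carrier A \<Longrightarrow>
      \<sigma> (pure_tensor K A A a \<one>\<^bsub>A\<^esub>) = pure_tensor K A A \<one>\<^bsub>A\<^esub> a"


section \<open>The universal property of the tensor product\<close>

lemma free_module_module:
  fixes K (structure)
  assumes "cring K"
  shows "module K (free_module K B)"
proof -
  interpret cring K by fact
  let ?F = "free_module K B"
  have supp: "\<lbrakk>f \<in> carrier ?F; g \<in> carrier ?F\<rbrakk> \<Longrightarrow>
      {b. f b \<oplus> g b \<noteq> \<zero>} \<subseteq> {b. f b \<noteq> \<zero>} \<union> {b. g b \<noteq> \<zero>}" for f g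
    by (auto simp: free_module_def)
  have closed: "\<lbrakk>f \<in> carrier ?F; g \<in> carrier ?F\<rbrakk> \<Longrightarrow> f \<oplus>\<^bsub>?F\<^esub> g \<in> carrier ?F" for f g
  proof -
    assume f: "f \<in> carrier ?F" and g: "g \<in> carrier ?F"
    have "finite {b. f b \<oplus> g b \<noteq> \<zero>}"
      by (rule finite_subset[OF supp[OF f g]]) (use f g in \<open>simp add: free_module_def\<close>)
    moreover have "{b. f b \<oplus> g b \<noteq> \<zero>} \<subseteq> B"
      using supp[OF f g] f g by (auto simp: free_module_def)
    moreover have "f b \<in> carrier K" "g b \<in> carrier K" for b
      using f g by (auto simp: free_module_def)
    ultimately show ?thesis by (auto simp: free_module_def)
  qed
  have val: "f \<in> carrier ?F \<Longrightarrow> f b \<in> carrier K" for f b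
    by (auto simp: free_module_def)
  show ?thesis
  proof (rule moduleI)
    show "abelian_group ?F"
    proof (rule abelian_groupI)
      fix f assume f: "f \<in> carrier ?F"
      have "{b. \<ominus> f b \<noteq> \<zero>} = {b. f b \<noteq> \<zero>}"
        using val[OF f] by (auto dest: arg_cong[of _ _ "a_inv K"])
      then have "(\<lambda>b. \<ominus> f b) \<in> carrier ?F"
        using f by (auto simp: free_module_def)
      moreover have "(\<lambda>b. \<ominus> f b) \<oplus>\<^bsub>?F\<^esub> f = \<zero>\<^bsub>?F\<^esub>"
        using val[OF f] by (auto simp: free_module_def l_neg)
      ultimately show "\<exists>g\<in>carrier ?F. g \<oplus>\<^bsub>?F\<^esub> f = \<zero>\<^bsub>?F\<^esub>" by blast
    next
      fix f g h assume "f \<in> carrier ?F" "g \<in> carrier ?F" "h \<in> carrier ?F"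
      note v = this[THEN val]
      show "f \<oplus>\<^bsub>?F\<^esub> g \<oplus>\<^bsub>?F\<^esub> h = f \<oplus>\<^bsub>?F\<^esub> (g \<oplus>\<^bsub>?F\<^esub> h)"
        using v by (auto simp: free_module_def a_assoc)
    next
      fix f g assume "f \<in> carrier ?F" "g \<in> carrier ?F"
      note v = this[THEN val]
      show "f \<oplus>\<^bsub>?F\<^esub> g = g \<oplus>\<^bsub>?F\<^esub> f"
        using v by (auto simp: free_module_def a_comm)
    next
      fix f assume "f \<in> carrier ?F"
      from val[OF this] show "\<zero>\<^bsub>?F\<^esub> \<oplus>\<^bsub>?F\<^esub> f = f" by (auto simp: free_module_def)
    qed (auto simp: closed, auto simp: free_module_def)
  next
    fix c f assume c: "c \<in> carrier K" and f: "f \<in> carrier ?F"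
    have "{b. c \<otimes> f b \<noteq> \<zero>} \<subseteq> {b. f b \<noteq> \<zero>}" using c by auto
    then show "c \<odot>\<^bsub>?F\<^esub> f \<in> carrier ?F"
      using c f by (auto simp: free_module_def intro: finite_subset)
  qed (auto simp: free_module_def l_distr r_distr m_assoc assms image_subset_iff)
qed

lemma (in module) submodule_generated_submodule:
  assumes "G \<subseteq> carrier M"
  shows "submodule (submodule_generated R M G) R M"
proof (rule submoduleI)
  let ?\<N> = "{N. submodule N R M \<and> G \<subseteq> N}"
  have c: "carrier M \<in> ?\<N>" using carrier_is_submodule assms by blast
  then show "submodule_generated R M G \<subseteq> carrier M"
    by (auto simp: submodule_generated_def)
  have z: "submodule N R M \<Longrightarrow> \<zero>\<^bsub>M\<^esub> \<in> N" for N
    using subgroup.one_closed[OF submodule.axioms(1)] by fastforce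
  show "\<zero>\<^bsub>M\<^esub> \<in> submodule_generated R M G"
    by (auto simp: submodule_generated_def z)
qed (auto simp: submodule_generated_def submoduleE)

lemma quotient_module_module:
  assumes "module K V" "submodule N K V"
  shows "module K (quotient_module V N)"
    and "\<And>c x. \<lbrakk>c \<in> carrier K; x \<in> carrier V\<rbrakk> \<Longrightarrow>
      c \<odot>\<^bsub>quotient_module V N\<^esub> (N +>\<^bsub>V\<^esub> x) = N +>\<^bsub>V\<^esub> (c \<odot>\<^bsub>V\<^esub> x)"
    and "\<And>x y. \<lbrakk>x \<in> carrier V; y \<in> carrier V\<rbrakk> \<Longrightarrow>
      (N +>\<^bsub>V\<^esub> x) \<oplus>\<^bsub>quotient_module V N\<^esub> (N +>\<^bsub>V\<^esub> y) = N +>\<^bsub>V\<^esub> (x \<oplus>\<^bsub>V\<^esub> y)"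
proof -
  interpret module K V by fact
  interpret N: submodule N K V by fact
  interpret N: abelian_subgroup N V
    by (rule abelian_subgroupI3)
       (auto intro: additive_subgroup.intro N.subgroup_axioms abelian_group_axioms)
  let ?Q = "quotient_module V N"
  show smult: "c \<odot>\<^bsub>?Q\<^esub> (N +>\<^bsub>V\<^esub> x) = N +>\<^bsub>V\<^esub> (c \<odot>\<^bsub>V\<^esub> x)"
    if "c \<in> carrier K" "x \<in> carrier V" for c x
  proof -
    have "N +>\<^bsub>V\<^esub> (c \<odot>\<^bsub>V\<^esub> y) = N +>\<^bsub>V\<^esub> (c \<odot>\<^bsub>V\<^esub> x)" if y: "y \<in> N +>\<^bsub>V\<^esub> x" for y
    proof -
      obtain n where n: "n \<in> N" "y = n \<oplus>\<^bsub>V\<^esub> x" using y by (auto simp: a_r_coset_def')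
      have nc: "n \<in> carrier V" using n by simp
      have "c \<odot>\<^bsub>V\<^esub> y = c \<odot>\<^bsub>V\<^esub> n \<oplus>\<^bsub>V\<^esub> c \<odot>\<^bsub>V\<^esub> x"
        using n nc \<open>c \<in> carrier K\<close> \<open>x \<in> carrier V\<close> by (simp add: smult_r_distr)
      then have "c \<odot>\<^bsub>V\<^esub> y \<in> N +>\<^bsub>V\<^esub> (c \<odot>\<^bsub>V\<^esub> x)"
        using n \<open>c \<in> carrier K\<close> by (auto simp: a_r_coset_def')
      then show ?thesis
        using N.a_repr_independence' that \<open>c \<in> carrier K\<close> \<open>x \<in> carrier V\<close> smult_closed by metis
    qed
    then have "(\<Union>y\<in>N +>\<^bsub>V\<^esub> x. N +>\<^bsub>V\<^esub> (c \<odot>\<^bsub>V\<^esub> y)) =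
        (\<Union>y\<in>N +>\<^bsub>V\<^esub> x. N +>\<^bsub>V\<^esub> (c \<odot>\<^bsub>V\<^esub> x))"
      by (rule SUP_cong[OF refl])
    moreover have "N +>\<^bsub>V\<^esub> x \<noteq> {}" using that N.a_rcos_self by blast
    ultimately show ?thesis by (simp add: quotient_module_def)
  qed
  show add: "(N +>\<^bsub>V\<^esub> x) \<oplus>\<^bsub>?Q\<^esub> (N +>\<^bsub>V\<^esub> y) = N +>\<^bsub>V\<^esub> (x \<oplus>\<^bsub>V\<^esub> y)"
    if "x \<in> carrier V" "y \<in> carrier V" for x y
    using that by (simp add: quotient_module_def N.a_rcos_sum)
  have carr: "X \<in> carrier ?Q \<longleftrightarrow> (\<exists>x\<in>carrier V. X = N +>\<^bsub>V\<^esub> x)" for X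
    by (auto simp: quotient_module_def A_RCOSETS_def')
  have zero: "\<zero>\<^bsub>?Q\<^esub> = N +>\<^bsub>V\<^esub> \<zero>\<^bsub>V\<^esub>"
    using N.a_subset by (simp add: quotient_module_def)
  have ab: "abelian_group ?Q"
  proof (rule abelian_groupI)
    fix X assume "X \<in> carrier ?Q"
    then obtain x where x: "x \<in> carrier V" "X = N +>\<^bsub>V\<^esub> x" by (auto simp: carr)
    have "(N +>\<^bsub>V\<^esub> (\<ominus>\<^bsub>V\<^esub> x)) \<oplus>\<^bsub>?Q\<^esub> X = \<zero>\<^bsub>?Q\<^esub>"
      using x by (simp add: add zero M.l_neg)
    then show "\<exists>Y\<in>carrier ?Q. Y \<oplus>\<^bsub>?Q\<^esub> X = \<zero>\<^bsub>?Q\<^esub>"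
      using x carr M.a_inv_closed by blast
  next
    fix X Y Z assume "X \<in> carrier ?Q" "Y \<in> carrier ?Q" "Z \<in> carrier ?Q"
    then obtain x y z where "x \<in> carrier V" "X = N +>\<^bsub>V\<^esub> x" "y \<in> carrier V" "Y = N +>\<^bsub>V\<^esub> y"
      "z \<in> carrier V" "Z = N +>\<^bsub>V\<^esub> z" by (auto simp: carr)
    then show "X \<oplus>\<^bsub>?Q\<^esub> Y \<oplus>\<^bsub>?Q\<^esub> Z = X \<oplus>\<^bsub>?Q\<^esub> (Y \<oplus>\<^bsub>?Q\<^esub> Z)"
      by (simp add: add M.a_assoc)
  next
    fix X Y assume "X \<in> carrier ?Q" "Y \<in> carrier ?Q"
    then obtain x y where xy: "x \<in> carrier V" "X = N +>\<^bsub>V\<^esub> x" "y \<in> carrier V" "Y = N +>\<^bsub>V\<^esub> y"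
      by (auto simp: carr)
    then show "X \<oplus>\<^bsub>?Q\<^esub> Y = Y \<oplus>\<^bsub>?Q\<^esub> X" by (simp add: add M.a_comm)
    show "X \<oplus>\<^bsub>?Q\<^esub> Y \<in> carrier ?Q" using xy add carr M.a_closed by metis
  next
    show "\<zero>\<^bsub>?Q\<^esub> \<in> carrier ?Q" using zero carr by blast
  next
    fix X assume "X \<in> carrier ?Q"
    then obtain x where x: "x \<in> carrier V" "X = N +>\<^bsub>V\<^esub> x" by (auto simp: carr)
    then show "\<zero>\<^bsub>?Q\<^esub> \<oplus>\<^bsub>?Q\<^esub> X = X" by (simp add: zero add)
  qed
  have smult_carr: "c \<odot>\<^bsub>?Q\<^esub> X \<in> carrier ?Q" if "c \<in> carrier K" "X \<in> carrier ?Q" for c X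
    using that smult carr smult_closed by metis
  show "module K ?Q"
    by (rule moduleI)
       (auto simp: ab carr smult add smult_l_distr smult_r_distr smult_assoc1 R.is_cring
         intro: smult_carr[unfolded carr])
qed

lemma free_gen_carrier:
  fixes K (structure)
  assumes "cring K" "b \<in> B"
  shows "free_gen K b \<in> carrier (free_module K B)"
proof -
  interpret cring K by fact
  have "{b'. free_gen K b b' \<noteq> \<zero>} \<subseteq> {b}" by (auto simp: free_gen_def)
  then have "finite {b'. free_gen K b b' \<noteq> \<zero>}" by (rule finite_subset) simp
  then show ?thesis using assms(2) by (auto simp: free_module_def free_gen_def split: if_splits)
qed

lemma tensor_relations_carrier:
  assumes "module K V" "module K W"
  shows "tensor_relations K V W \<subseteq> carrier (free_module K (carrier V \<times> carrier W))"
proof -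
  interpret V: module K V by fact
  interpret W: module K W by fact
  interpret F: module K "free_module K (carrier V \<times> carrier W)"
    by (rule free_module_module) (rule V.R.is_cring)
  have g: "\<lbrakk>v \<in> carrier V; w \<in> carrier W\<rbrakk> \<Longrightarrow>
      free_gen K (v, w) \<in> carrier (free_module K (carrier V \<times> carrier W))" for v w
    by (rule free_gen_carrier) (auto intro: V.R.is_cring)
  show ?thesis
    unfolding tensor_relations_def Let_def by (auto intro!: F.M.minus_closed F.M.a_closed F.smult_closed g)
qed

lemma tensor_null_submodule:
  assumes "module K V" "module K W"
  shows "submodule (tensor_null K V W) K (free_module K (carrier V \<times> carrier W))"
  unfolding tensor_null_def
  by (intro module.submodule_generated_submodule tensor_relations_carrier free_module_module assms
      module.axioms(1)[OF assms(1)])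

lemma tensor_space_module:
  assumes "module K V" "module K W"
  shows "module K (tensor_space K V W)"
  unfolding tensor_space_def
  by (intro quotient_module_module tensor_null_submodule free_module_module assms
      module.axioms(1)[OF assms(1)])

lemma tensor_simps [simp]:
  "carrier (tensor K V W) = carrier (tensor_space K V W)"
  "zero (tensor K V W) = zero (tensor_space K V W)"
  "add (tensor K V W) = add (tensor_space K V W)"
  "smult (tensor K V W) = smult (tensor_space K V W)"
  by (simp_all add: tensor_def)

lemma tensor_module:
  assumes "module K V" "module K W"
  shows "module K (tensor K V W)"
proof -
  interpret T: module K "tensor_space K V W" by (rule tensor_space_module[OF assms])
  show ?thesis
  proof (rule moduleI)
    show "abelian_group (tensor K V W)"
    proof (rule abelian_groupI)
      fix x assume "x \<in> carrier (tensor K V W)"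
      then show "\<exists>y\<in>carrier (tensor K V W). y \<oplus>\<^bsub>tensor K V W\<^esub> x = \<zero>\<^bsub>tensor K V W\<^esub>"
        by (intro bexI[of _ "\<ominus>\<^bsub>tensor_space K V W\<^esub> x"]) (simp_all add: T.M.l_neg)
    qed (simp_all add: T.M.a_ac)
  qed (auto simp: T.R.is_cring T.smult_l_distr T.smult_r_distr T.smult_assoc1)
qed

definition free_lift where
  "free_lift K X \<beta> f = (\<Oplus>\<^bsub>X\<^esub>p\<in>{p. f p \<noteq> \<zero>\<^bsub>K\<^esub>}. f p \<odot>\<^bsub>X\<^esub> \<beta> (fst p) (snd p))"

lemma free_lift_superset:
  assumes "module K X" "finite P" "P \<subseteq> B" "{p. f p \<noteq> \<zero>\<^bsub>K\<^esub>} \<subseteq> P"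
    and "\<And>p. f p \<in> carrier K" "\<And>p. p \<in> B \<Longrightarrow> \<beta> (fst p) (snd p) \<in> carrier X"
  shows "free_lift K X \<beta> f = (\<Oplus>\<^bsub>X\<^esub>p\<in>P. f p \<odot>\<^bsub>X\<^esub> \<beta> (fst p) (snd p))"
proof -
  interpret module K X by fact
  show ?thesis
    unfolding free_lift_def
    by (rule M.add.finprod_mono_neutral_cong_left) (use assms in \<open>auto intro!: smult_closed\<close>)
qed

lemma free_lift_linear:
  assumes "module K X" and \<beta>: "\<And>p. p \<in> B \<Longrightarrow> \<beta> (fst p) (snd p) \<in> carrier X"
  shows "free_lift K X \<beta> \<in> linear_maps K (free_module K B) X"
proof -
  interpret module K X by fact
  let ?F = "free_module K B"
  interpret F: module K ?F by (rule free_module_module) (rule R.is_cring)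
  have val: "f \<in> carrier ?F \<Longrightarrow> f p \<in> carrier K"
    and fin: "f \<in> carrier ?F \<Longrightarrow> finite {p. f p \<noteq> \<zero>\<^bsub>K\<^esub>}"
    and sub: "f \<in> carrier ?F \<Longrightarrow> {p. f p \<noteq> \<zero>\<^bsub>K\<^esub>} \<subseteq> B" for f p
    by (auto simp: free_module_def)
  note sup = free_lift_superset[OF assms(1), of _ B _ \<beta>, OF _ _ _ _ \<beta>]
  have cl: "f \<in> carrier ?F \<Longrightarrow> P \<subseteq> B \<Longrightarrow> (\<lambda>p. f p \<odot>\<^bsub>X\<^esub> \<beta> (fst p) (snd p)) \<in> P \<rightarrow> carrier X" for f P
    using val \<beta> by (auto intro!: smult_closed)
  have c1: "free_lift K X \<beta> f \<in> carrier X" if "f \<in> carrier ?F" for f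
    unfolding free_lift_def by (rule M.finsum_closed) (rule cl[OF that sub[OF that]])
  have c2: "free_lift K X \<beta> (f \<oplus>\<^bsub>?F\<^esub> g) = free_lift K X \<beta> f \<oplus>\<^bsub>X\<^esub> free_lift K X \<beta> g"
    if f: "f \<in> carrier ?F" and g: "g \<in> carrier ?F" for f g
  proof -
    let ?P = "{p. f p \<noteq> \<zero>\<^bsub>K\<^esub>} \<union> {p. g p \<noteq> \<zero>\<^bsub>K\<^esub>}"
    have P: "finite ?P" "?P \<subseteq> B" using fin sub f g by auto
    have fg: "(f \<oplus>\<^bsub>?F\<^esub> g) p = f p \<oplus>\<^bsub>K\<^esub> g p" for p by (simp add: free_module_def)
    have s: "{p. (f \<oplus>\<^bsub>?F\<^esub> g) p \<noteq> \<zero>\<^bsub>K\<^esub>} \<subseteq> ?P" unfolding fg by auto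
    have "free_lift K X \<beta> (f \<oplus>\<^bsub>?F\<^esub> g) =
        (\<Oplus>\<^bsub>X\<^esub>p\<in>?P. (f \<oplus>\<^bsub>?F\<^esub> g) p \<odot>\<^bsub>X\<^esub> \<beta> (fst p) (snd p))"
      by (rule sup[OF P s]) (auto intro: val[OF F.M.a_closed[OF f g]])
    also have "\<dots> = (\<Oplus>\<^bsub>X\<^esub>p\<in>?P. f p \<odot>\<^bsub>X\<^esub> \<beta> (fst p) (snd p) \<oplus>\<^bsub>X\<^esub> g p \<odot>\<^bsub>X\<^esub> \<beta> (fst p) (snd p))"
    proof (rule M.finsum_cong'[OF refl])
      show "(\<lambda>p. f p \<odot>\<^bsub>X\<^esub> \<beta> (fst p) (snd p) \<oplus>\<^bsub>X\<^esub> g p \<odot>\<^bsub>X\<^esub> \<beta> (fst p) (snd p)) \<in> ?P \<rightarrow> carrier X"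
        using cl[OF f P(2)] cl[OF g P(2)] by (intro funcsetI M.a_closed) (auto simp: Pi_def)
      fix p assume "p \<in> ?P"
      then have "p \<in> B" using P by blast
      then show "(f \<oplus>\<^bsub>?F\<^esub> g) p \<odot>\<^bsub>X\<^esub> \<beta> (fst p) (snd p) =
          f p \<odot>\<^bsub>X\<^esub> \<beta> (fst p) (snd p) \<oplus>\<^bsub>X\<^esub> g p \<odot>\<^bsub>X\<^esub> \<beta> (fst p) (snd p)"
        unfolding fg by (intro smult_l_distr val f g \<beta>)
    qed
    also have "\<dots> = (\<Oplus>\<^bsub>X\<^esub>p\<in>?P. f p \<odot>\<^bsub>X\<^esub> \<beta> (fst p) (snd p)) \<oplus>\<^bsub>X\<^esub> (\<Oplus>\<^bsub>X\<^esub>p\<in>?P. g p \<odot>\<^bsub>X\<^esub> \<beta> (fst p) (snd p))"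
      by (rule M.finsum_addf) (rule cl[OF f P(2)] cl[OF g P(2)])+
    also have "(\<Oplus>\<^bsub>X\<^esub>p\<in>?P. f p \<odot>\<^bsub>X\<^esub> \<beta> (fst p) (snd p)) = free_lift K X \<beta> f"
      by (rule sup[OF P, symmetric]) (auto intro: val[OF f])
    also have "(\<Oplus>\<^bsub>X\<^esub>p\<in>?P. g p \<odot>\<^bsub>X\<^esub> \<beta> (fst p) (snd p)) = free_lift K X \<beta> g"
      by (rule sup[OF P, symmetric]) (auto intro: val[OF g])
    finally show ?thesis .
  qed
  have c3: "free_lift K X \<beta> (c \<odot>\<^bsub>?F\<^esub> f) = c \<odot>\<^bsub>X\<^esub> free_lift K X \<beta> f"
    if c: "c \<in> carrier K" and f: "f \<in> carrier ?F" for c f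
  proof -
    let ?P = "{p. f p \<noteq> \<zero>\<^bsub>K\<^esub>}"
    have P: "finite ?P" "?P \<subseteq> B" using fin sub f by auto
    have cf: "(c \<odot>\<^bsub>?F\<^esub> f) p = c \<otimes>\<^bsub>K\<^esub> f p" for p by (simp add: free_module_def)
    have s: "{p. (c \<odot>\<^bsub>?F\<^esub> f) p \<noteq> \<zero>\<^bsub>K\<^esub>} \<subseteq> ?P" unfolding cf using c by auto
    have "free_lift K X \<beta> (c \<odot>\<^bsub>?F\<^esub> f) = (\<Oplus>\<^bsub>X\<^esub>p\<in>?P. (c \<odot>\<^bsub>?F\<^esub> f) p \<odot>\<^bsub>X\<^esub> \<beta> (fst p) (snd p))"
      by (rule sup[OF P s]) (auto intro: val[OF F.smult_closed[OF c f]])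
    also have "\<dots> = (\<Oplus>\<^bsub>X\<^esub>p\<in>?P. c \<odot>\<^bsub>X\<^esub> (f p \<odot>\<^bsub>X\<^esub> \<beta> (fst p) (snd p)))"
    proof (rule M.finsum_cong'[OF refl])
      show "(\<lambda>p. c \<odot>\<^bsub>X\<^esub> (f p \<odot>\<^bsub>X\<^esub> \<beta> (fst p) (snd p))) \<in> ?P \<rightarrow> carrier X"
        using cl[OF f P(2)] c by (auto simp: Pi_def)
      fix p assume "p \<in> ?P"
      then have "p \<in> B" using P by blast
      then show "(c \<odot>\<^bsub>?F\<^esub> f) p \<odot>\<^bsub>X\<^esub> \<beta> (fst p) (snd p) = c \<odot>\<^bsub>X\<^esub> (f p \<odot>\<^bsub>X\<^esub> \<beta> (fst p) (snd p))"
        unfolding cf by (intro smult_assoc1 val f c \<beta>)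
    qed
    also have "\<dots> = c \<odot>\<^bsub>X\<^esub> free_lift K X \<beta> f"
      unfolding free_lift_def by (rule finsum_smult_ldistr[symmetric, OF P(1) c cl[OF f P(2)]])
    finally show ?thesis .
  qed
  show ?thesis unfolding linear_maps_def using c1 c2 c3 by blast
qed

lemma free_lift_gen:
  assumes "field K" "module K X" "\<beta> v w \<in> carrier X"
  shows "free_lift K X \<beta> (free_gen K (v, w)) = \<beta> v w"
proof -
  interpret field K by fact
  interpret module K X by fact
  have "{p. free_gen K (v, w) p \<noteq> \<zero>\<^bsub>K\<^esub>} = {(v, w)}" by (auto simp: free_gen_def)
  moreover have "free_gen K (v, w) (v, w) = \<one>\<^bsub>K\<^esub>" by (simp add: free_gen_def)
  ultimately show ?thesis using assms(3) by (simp add: free_lift_def)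
qed

lemma linear_mapsD:
  assumes "f \<in> linear_maps K V W"
  shows "x \<in> carrier V \<Longrightarrow> f x \<in> carrier W"
    and "\<lbrakk>x \<in> carrier V; y \<in> carrier V\<rbrakk> \<Longrightarrow> f (x \<oplus>\<^bsub>V\<^esub> y) = f x \<oplus>\<^bsub>W\<^esub> f y"
    and "\<lbrakk>c \<in> carrier K; x \<in> carrier V\<rbrakk> \<Longrightarrow> f (c \<odot>\<^bsub>V\<^esub> x) = c \<odot>\<^bsub>W\<^esub> f x"
  using assms by (auto simp: linear_maps_def)

lemma linear_maps_zero_minus:
  assumes "module K V" "module K W" "f \<in> linear_maps K V W"
  shows "f \<zero>\<^bsub>V\<^esub> = \<zero>\<^bsub>W\<^esub>"
    and "x \<in> carrier V \<Longrightarrow> f (\<ominus>\<^bsub>V\<^esub> x) = \<ominus>\<^bsub>W\<^esub> f x"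
proof -
  interpret V: module K V by fact
  interpret W: module K W by fact
  have "abelian_group_hom V W f"
  proof (rule abelian_group_homI[OF V.M.abelian_group_axioms W.M.abelian_group_axioms])
    show "group_hom (add_monoid V) (add_monoid W) f"
    proof (rule group_hom.intro[OF V.M.a_group W.M.a_group group_hom_axioms.intro])
      show "f \<in> hom (add_monoid V) (add_monoid W)"
        by (rule homI) (simp_all add: linear_mapsD[OF assms(3)])
    qed
  qed
  then interpret f: abelian_group_hom V W f .
  show "f \<zero>\<^bsub>V\<^esub> = \<zero>\<^bsub>W\<^esub>" by simp
  show "x \<in> carrier V \<Longrightarrow> f (\<ominus>\<^bsub>V\<^esub> x) = \<ominus>\<^bsub>W\<^esub> f x" by simp
qed

lemma free_lift_tensor_null:
  assumes "field K" "module K V" "module K W" "module K X" and \<beta>: "\<beta> \<in> bilinear_maps K V W X"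
    and n: "n \<in> tensor_null K V W"
  shows "free_lift K X \<beta> n = \<zero>\<^bsub>X\<^esub>"
proof -
  let ?B = "carrier V \<times> carrier W"
  let ?F = "free_module K ?B"
  let ?L = "free_lift K X \<beta>"
  interpret field K by fact
  interpret V: module K V by fact
  interpret W: module K W by fact
  interpret X: module K X by fact
  interpret F: module K ?F by (rule free_module_module) (rule module.axioms(1)[OF assms(2)])
  have b: "\<beta> v w \<in> carrier X" if "v \<in> carrier V" "w \<in> carrier W" for v w
    using \<beta> that by (auto simp: bilinear_maps_def linear_maps_def)
  have L: "?L \<in> linear_maps K ?F X"
    by (rule free_lift_linear[OF assms(4)]) (auto intro: b)
  note L1 = linear_mapsD[OF L] and L0 = linear_maps_zero_minus[OF F.module_axioms assms(4) L]
  have g: "\<lbrakk>v \<in> carrier V; w \<in> carrier W\<rbrakk> \<Longrightarrow> free_gen K (v, w) \<in> carrier ?F" for v w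
    by (rule free_gen_carrier) (auto intro: module.axioms(1)[OF assms(2)])
  have Lg: "\<lbrakk>v \<in> carrier V; w \<in> carrier W\<rbrakk> \<Longrightarrow> ?L (free_gen K (v, w)) = \<beta> v w" for v w
    by (rule free_lift_gen[OF assms(1,4)]) (rule b)
  have Lm: "\<lbrakk>x \<in> carrier ?F; y \<in> carrier ?F; ?L x = ?L y\<rbrakk> \<Longrightarrow> ?L (x \<ominus>\<^bsub>?F\<^esub> y) = \<zero>\<^bsub>X\<^esub>" for x y
    by (simp add: a_minus_def L1 L0 X.M.r_neg)
  let ?N = "{f \<in> carrier ?F. ?L f = \<zero>\<^bsub>X\<^esub>}"
  have N: "submodule ?N K ?F"
    by (rule F.submoduleI) (auto simp: L1 L0)
  have \<beta>a: "\<lbrakk>v \<in> carrier V; v' \<in> carrier V; w \<in> carrier W\<rbrakk> \<Longrightarrow> \<beta> (v \<oplus>\<^bsub>V\<^esub> v') w = \<beta> v w \<oplus>\<^bsub>X\<^esub> \<beta> v' w"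
    and \<beta>b: "\<lbrakk>v \<in> carrier V; w \<in> carrier W; w' \<in> carrier W\<rbrakk> \<Longrightarrow> \<beta> v (w \<oplus>\<^bsub>W\<^esub> w') = \<beta> v w \<oplus>\<^bsub>X\<^esub> \<beta> v w'"
    and \<beta>c: "\<lbrakk>c \<in> carrier K; v \<in> carrier V; w \<in> carrier W\<rbrakk> \<Longrightarrow> \<beta> (c \<odot>\<^bsub>V\<^esub> v) w = c \<odot>\<^bsub>X\<^esub> \<beta> v w"
    and \<beta>d: "\<lbrakk>c \<in> carrier K; v \<in> carrier V; w \<in> carrier W\<rbrakk> \<Longrightarrow> \<beta> v (c \<odot>\<^bsub>W\<^esub> w) = c \<odot>\<^bsub>X\<^esub> \<beta> v w"
    for v v' w w' c
    using \<beta> by (auto simp: bilinear_maps_def linear_maps_def)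
  have "tensor_relations K V W \<subseteq> ?N"
  proof
    fix r assume r: "r \<in> tensor_relations K V W"
    have "?L r = \<zero>\<^bsub>X\<^esub>"
      using r unfolding tensor_relations_def Let_def
      by (elim UnE CollectE exE conjE; hypsubst; intro Lm F.M.a_closed F.smult_closed g)
         (simp_all add: L1 Lg g \<beta>a \<beta>b \<beta>c \<beta>d)
    then show "r \<in> ?N" using r tensor_relations_carrier[OF assms(2,3)] by blast
  qed
  then have "tensor_null K V W \<subseteq> ?N"
    using N by (auto simp: tensor_null_def submodule_generated_def)
  then show ?thesis using n by blast
qed

lemma tensor_carrier_iff:
  "x \<in> carrier (tensor_space K V W) \<longleftrightarrow>
    (\<exists>f\<in>carrier (free_module K (carrier V \<times> carrier W)).
      x = tensor_null K V W +>\<^bsub>free_module K (carrier V \<times> carrier W)\<^esub> f)"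
  by (auto simp: tensor_space_def quotient_module_def A_RCOSETS_def')

lemma tensor_lift_coset:
  assumes "field K" "module K V" "module K W" "module K X" and \<beta>: "\<beta> \<in> bilinear_maps K V W X"
    and f: "f \<in> carrier (free_module K (carrier V \<times> carrier W))"
  shows "tensor_lift K X \<beta> (tensor_null K V W +>\<^bsub>free_module K (carrier V \<times> carrier W)\<^esub> f)
    = free_lift K X \<beta> f"
proof -
  let ?B = "carrier V \<times> carrier W"
  let ?F = "free_module K ?B"
  let ?L = "free_lift K X \<beta>"
  interpret V: module K V by fact
  interpret X: module K X by fact
  interpret F: module K ?F by (rule free_module_module) (rule V.R.is_cring)
  note N = tensor_null_submodule[OF assms(2,3)]
  have b: "\<beta> v w \<in> carrier X" if "v \<in> carrier V" "w \<in> carrier W" for v w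
    using \<beta> that by (auto simp: bilinear_maps_def linear_maps_def)
  have L: "?L \<in> linear_maps K ?F X"
    by (rule free_lift_linear[OF assms(4)]) (auto intro: b)
  have "?L g = ?L f" if "g \<in> tensor_null K V W +>\<^bsub>?F\<^esub> f" for g
  proof -
    obtain n where n: "n \<in> tensor_null K V W" "g = n \<oplus>\<^bsub>?F\<^esub> f"
      using \<open>g \<in> _\<close> by (auto simp: a_r_coset_def')
    have "n \<in> carrier ?F" using F.submoduleE(1)[OF N] n by blast
    then show ?thesis
      using n f by (simp add: linear_mapsD[OF L] free_lift_tensor_null[OF assms(1-5)])
  qed
  moreover have "f \<in> tensor_null K V W +>\<^bsub>?F\<^esub> f"
  proof -
    have "\<zero>\<^bsub>?F\<^esub> \<in> tensor_null K V W"
      using subgroup.one_closed[OF submodule.axioms(1)[OF N]] by simp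
    then show ?thesis using f by (force simp: a_r_coset_def')
  qed
  ultimately have "?L ` (tensor_null K V W +>\<^bsub>?F\<^esub> f) = {?L f}" by blast
  then have "the_elem (?L ` (tensor_null K V W +>\<^bsub>?F\<^esub> f)) = ?L f" by simp
  then show ?thesis unfolding tensor_lift_def free_lift_def .
qed

lemma pure_tensor_closed:
  assumes "module K V" "v \<in> carrier V" "w \<in> carrier W"
  shows "pure_tensor K V W v w \<in> carrier (tensor K V W)"
  using free_gen_carrier[OF module.axioms(1)[OF assms(1)], of "(v, w)" "carrier V \<times> carrier W"] assms
  by (auto simp: tensor_carrier_iff pure_tensor_def)

theorem tensor_lift_pure:
  assumes "field K" "module K V" "module K W" "module K X" "\<beta> \<in> bilinear_maps K V W X"
    and "v \<in> carrier V" "w \<in> carrier W"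
  shows "tensor_lift K X \<beta> (pure_tensor K V W v w) = \<beta> v w"
proof -
  have "free_gen K (v, w) \<in> carrier (free_module K (carrier V \<times> carrier W))"
    by (rule free_gen_carrier[OF module.axioms(1)[OF assms(2)]]) (simp add: assms(6,7))
  moreover have "\<beta> v w \<in> carrier X"
    using assms by (auto simp: bilinear_maps_def linear_maps_def)
  ultimately show ?thesis
    unfolding pure_tensor_def
    by (simp add: tensor_lift_coset[OF assms(1-5)] free_lift_gen[OF assms(1,4)])
qed

theorem tensor_lift_linear:
  assumes "field K" "module K V" "module K W" "module K X" and \<beta>: "\<beta> \<in> bilinear_maps K V W X"
  shows "tensor_lift K X \<beta> \<in> linear_maps K (tensor K V W) X"
proof -
  let ?B = "carrier V \<times> carrier W"
  let ?F = "free_module K ?B"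
  have F: "module K ?F" by (rule free_module_module) (rule module.axioms(1)[OF assms(2)])
  interpret F: module K ?F by (rule F)
  have b: "\<beta> v w \<in> carrier X" if "v \<in> carrier V" "w \<in> carrier W" for v w
    using \<beta> that by (auto simp: bilinear_maps_def linear_maps_def)
  have L: "free_lift K X \<beta> \<in> linear_maps K ?F X"
    by (rule free_lift_linear[OF assms(4)]) (auto intro: b)
  note Q = quotient_module_module(2,3)[OF F tensor_null_submodule[OF assms(2,3)], folded tensor_space_def]
  show ?thesis
    unfolding linear_maps_def
    by (auto simp: tensor_carrier_iff Q tensor_lift_coset[OF assms] linear_mapsD[OF L])
qed

text \<open>Every tensor is a finite sum of pure tensors, so the linear extension is unique.\<close>

theorem tensor_induct [consumes 3, case_names zero pure add]:
  assumes "module K V" "module K W" "x \<in> carrier (tensor K V W)"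
    and zero: "P \<zero>\<^bsub>tensor K V W\<^esub>"
    and pure: "\<And>v w. \<lbrakk>v \<in> carrier V; w \<in> carrier W\<rbrakk> \<Longrightarrow> P (pure_tensor K V W v w)"
    and add: "\<And>x y. \<lbrakk>x \<in> carrier (tensor K V W); y \<in> carrier (tensor K V W); P x; P y\<rbrakk>
      \<Longrightarrow> P (x \<oplus>\<^bsub>tensor K V W\<^esub> y)"
  shows "P x"
proof -
  let ?B = "carrier V \<times> carrier W"
  let ?F = "free_module K ?B"
  let ?T = "tensor_space K V W"
  let ?N = "tensor_null K V W"
  interpret V: module K V by fact
  interpret F: module K ?F by (rule free_module_module) (rule V.R.is_cring)
  note N = tensor_null_submodule[OF assms(1,2)]
  interpret N: submodule ?N K ?F by (rule N)
  interpret N: abelian_subgroup ?N ?F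
    by (rule abelian_subgroupI3)
       (auto intro: additive_subgroup.intro N.subgroup_axioms F.M.abelian_group_axioms)
  note Q = quotient_module_module(2,3)[OF F.module_axioms N, folded tensor_space_def]
  have g: "p \<in> ?B \<Longrightarrow> free_gen K p \<in> carrier ?F" for p
    by (rule free_gen_carrier[OF V.R.is_cring])
  have scaled: "?N +>\<^bsub>?F\<^esub> (c \<odot>\<^bsub>?F\<^esub> free_gen K (v, w)) = pure_tensor K V W (c \<odot>\<^bsub>V\<^esub> v) w"
    if "c \<in> carrier K" "v \<in> carrier V" "w \<in> carrier W" for c v w
  proof -
    have c: "c \<odot>\<^bsub>?F\<^esub> free_gen K (v, w) \<in> carrier ?F" "free_gen K (c \<odot>\<^bsub>V\<^esub> v, w) \<in> carrier ?F"
      using that g by auto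
    have "free_gen K (c \<odot>\<^bsub>V\<^esub> v, w) \<ominus>\<^bsub>?F\<^esub> c \<odot>\<^bsub>?F\<^esub> free_gen K (v, w) \<in> tensor_relations K V W"
      unfolding tensor_relations_def Let_def using that by blast
    then have "free_gen K (c \<odot>\<^bsub>V\<^esub> v, w) \<ominus>\<^bsub>?F\<^esub> c \<odot>\<^bsub>?F\<^esub> free_gen K (v, w) \<in> ?N"
      by (auto simp: tensor_null_def submodule_generated_def)
    then have "free_gen K (c \<odot>\<^bsub>V\<^esub> v, w) \<in> ?N +>\<^bsub>?F\<^esub> (c \<odot>\<^bsub>?F\<^esub> free_gen K (v, w))"
      using c F.M.abelian_group_axioms N.a_rcos_module by (simp add: a_minus_def)
    then show ?thesis
      unfolding pure_tensor_def by (rule N.a_repr_independence'[OF _ c(1)])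
  qed
  have "P (?N +>\<^bsub>?F\<^esub> f)" if "finite S" "f \<in> carrier ?F" "{p. f p \<noteq> \<zero>\<^bsub>K\<^esub>} = S" for S f
    using that
  proof (induction S arbitrary: f rule: finite_induct)
    case empty
    then have "f = \<zero>\<^bsub>?F\<^esub>" by (auto simp: free_module_def)
    then show ?case using zero N.a_subset by (simp add: tensor_space_def quotient_module_def)
  next
    case (insert p S)
    define f' where "f' = f(p := \<zero>\<^bsub>K\<^esub>)"
    have p: "p \<in> ?B" "f p \<in> carrier K" using insert by (auto simp: free_module_def)
    have s: "{q. f' q \<noteq> \<zero>\<^bsub>K\<^esub>} = S"
      using insert.hyps insert.prems(2) by (auto simp: f'_def split: if_splits)
    have f': "f' \<in> carrier ?F"
      using insert.prems insert.hyps s by (auto simp: free_module_def f'_def split: if_splits)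
    have "f = f p \<odot>\<^bsub>?F\<^esub> free_gen K p \<oplus>\<^bsub>?F\<^esub> f'"
    proof
      fix q
      have "f q \<in> carrier K" using insert.prems by (auto simp: free_module_def)
      then show "f q = (f p \<odot>\<^bsub>?F\<^esub> free_gen K p \<oplus>\<^bsub>?F\<^esub> f') q"
        using p by (auto simp: free_module_def free_gen_def f'_def)
    qed
    then have "?N +>\<^bsub>?F\<^esub> f = (?N +>\<^bsub>?F\<^esub> (f p \<odot>\<^bsub>?F\<^esub> free_gen K p)) \<oplus>\<^bsub>?T\<^esub> (?N +>\<^bsub>?F\<^esub> f')"
      using Q(2)[OF F.smult_closed[OF p(2) g[OF p(1)]] f'] by simp
    moreover have "?N +>\<^bsub>?F\<^esub> (f p \<odot>\<^bsub>?F\<^esub> free_gen K p) = pure_tensor K V W (f p \<odot>\<^bsub>V\<^esub> fst p) (snd p)"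
      using scaled[of "f p" "fst p" "snd p"] p by (auto simp: mem_Times_iff)
    moreover have "P (?N +>\<^bsub>?F\<^esub> f')" by (rule insert.IH[OF f' s])
    moreover have "f p \<odot>\<^bsub>V\<^esub> fst p \<in> carrier V" "snd p \<in> carrier W" using p by auto
    moreover have "?N +>\<^bsub>?F\<^esub> f' \<in> carrier ?T" using f' by (auto simp: tensor_carrier_iff)
    ultimately show ?case
      using add[of "pure_tensor K V W (f p \<odot>\<^bsub>V\<^esub> fst p) (snd p)" "?N +>\<^bsub>?F\<^esub> f'"] pure
        pure_tensor_closed[OF assms(1), of "f p \<odot>\<^bsub>V\<^esub> fst p" "snd p" W] by simp
  qed
  moreover obtain f where "f \<in> carrier ?F" "x = ?N +>\<^bsub>?F\<^esub> f"
    using assms(3) by (auto simp: tensor_carrier_iff)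
  ultimately show ?thesis by (auto simp: free_module_def)
qed

theorem pure_tensor_bilinear:
  assumes "module K V" "module K W"
  shows "pure_tensor K V W \<in> bilinear_maps K V W (tensor K V W)"
proof -
  let ?B = "carrier V \<times> carrier W"
  let ?F = "free_module K ?B"
  let ?T = "tensor_space K V W"
  let ?N = "tensor_null K V W"
  interpret V: module K V by fact
  interpret W: module K W by fact
  interpret F: module K ?F by (rule free_module_module) (rule module.axioms(1)[OF assms(1)])
  note N = tensor_null_submodule[OF assms]
  interpret N: submodule ?N K ?F by (rule N)
  interpret N: abelian_subgroup ?N ?F
    by (rule abelian_subgroupI3)
       (auto intro: additive_subgroup.intro N.subgroup_axioms F.M.abelian_group_axioms)
  note Q = quotient_module_module(2,3)[OF F.module_axioms N, folded tensor_space_def]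
  have g: "free_gen K (v, w) \<in> carrier ?F" if "v \<in> carrier V" "w \<in> carrier W" for v w
    by (rule free_gen_carrier[OF module.axioms(1)[OF assms(1)]]) (simp add: that)
  have eq: "?N +>\<^bsub>?F\<^esub> f = ?N +>\<^bsub>?F\<^esub> h"
    if "f \<ominus>\<^bsub>?F\<^esub> h \<in> tensor_relations K V W" "f \<in> carrier ?F" "h \<in> carrier ?F" for f h
  proof -
    have "f \<ominus>\<^bsub>?F\<^esub> h \<in> ?N"
      using that(1) by (auto simp: tensor_null_def submodule_generated_def)
    then have "f \<in> ?N +>\<^bsub>?F\<^esub> h"
      using that N.a_rcos_module F.M.abelian_group_axioms by (simp add: a_minus_def)
    then show ?thesis using N.a_repr_independence'[OF _ that(3)] by simp
  qed
  have a: "?N +>\<^bsub>?F\<^esub> free_gen K (v \<oplus>\<^bsub>V\<^esub> v', w) =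
      ?N +>\<^bsub>?F\<^esub> (free_gen K (v, w) \<oplus>\<^bsub>?F\<^esub> free_gen K (v', w))"
    if "v \<in> carrier V" "v' \<in> carrier V" "w \<in> carrier W" for v v' w
    by (rule eq) (use that in \<open>simp_all add: g\<close>, unfold tensor_relations_def Let_def, blast)
  have b: "?N +>\<^bsub>?F\<^esub> free_gen K (v, w \<oplus>\<^bsub>W\<^esub> w') =
      ?N +>\<^bsub>?F\<^esub> (free_gen K (v, w) \<oplus>\<^bsub>?F\<^esub> free_gen K (v, w'))"
    if "v \<in> carrier V" "w \<in> carrier W" "w' \<in> carrier W" for v w w'
    by (rule eq) (use that in \<open>simp_all add: g\<close>, unfold tensor_relations_def Let_def, blast)
  have c: "?N +>\<^bsub>?F\<^esub> free_gen K (c \<odot>\<^bsub>V\<^esub> v, w) = ?N +>\<^bsub>?F\<^esub> (c \<odot>\<^bsub>?F\<^esub> free_gen K (v, w))"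
    if "c \<in> carrier K" "v \<in> carrier V" "w \<in> carrier W" for c v w
    by (rule eq) (use that in \<open>simp_all add: g\<close>, unfold tensor_relations_def Let_def, blast)
  have d: "?N +>\<^bsub>?F\<^esub> free_gen K (v, c \<odot>\<^bsub>W\<^esub> w) = ?N +>\<^bsub>?F\<^esub> (c \<odot>\<^bsub>?F\<^esub> free_gen K (v, w))"
    if "c \<in> carrier K" "v \<in> carrier V" "w \<in> carrier W" for c v w
    by (rule eq) (use that in \<open>simp_all add: g\<close>, unfold tensor_relations_def Let_def, blast)
  show ?thesis
    using pure_tensor_closed[OF assms(1), of _ _ W]
    by (simp add: bilinear_maps_def linear_maps_def)
       (simp add: pure_tensor_def Q g a b c d)
qed

end

theory Submission
  imports Defs
begin

text \<open>
  Let \<open>H \<otimes> H\<close> act on \<open>A \<otimes> A\<close> factorwise. Then \<open>\<sigma>\<close> is the action of \<open>R\<close> followed by the flip, so it is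
  invertible because \<open>R\<close> is, and it commutes with the action of \<open>H\<close> through \<open>\<Delta>\<close> because
  \<open>\<Delta>\<^sup>o\<^sup>p(h) R = R \<Delta>(h)\<close>. By \<open>(id \<otimes> \<Delta>) R = R\<^sub>1\<^sub>3 R\<^sub>1\<^sub>2\<close>, the map \<open>\<sigma>\<^sub>2 \<sigma>\<^sub>1\<close> sends \<open>a \<otimes> q\<close> with \<open>q \<in> A \<otimes> A\<close> to
  \<open>\<Sum>\<^sub>i t\<^sub>i \<cdot> q \<otimes> s\<^sub>i \<cdot> a\<close>. Since \<open>\<sigma>\<close> and the product of \<open>A\<close> commute with the action of \<open>t\<^sub>i\<close>, applying
  them to \<open>q\<close> before or after this map gives the same result: this is the Yang-Baxter equation and
  the second product identity. The first product identity comes from the other hexagon in the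
  same way.
\<close>

text \<open>As simp rules these would rewrite the carrier and the operations of
  \<open>tensor K V W\<close> to those of \<open>tensor_space K V W\<close>, and facts stated for
  \<open>tensor\<close> would no longer match.\<close>

declare tensor_simps [simp del]

section \<open>Linear and bilinear maps\<close>

lemma linear_maps_cong:
  assumes "module K V" "f \<in> linear_maps K V W" "\<And>x. x \<in> carrier V \<Longrightarrow> g x = f x"
  shows "g \<in> linear_maps K V W"
proof -
  interpret V: module K V by fact
  show ?thesis using assms(2,3) by (auto simp: linear_maps_def)
qed

lemma linear_maps_ident: "(\<lambda>x. x) \<in> linear_maps K V V"
  by (simp add: linear_maps_def)

lemma linear_maps_id: "id \<in> linear_maps K V V"
  by (simp add: linear_maps_def)

lemma linear_maps_compose:
  assumes "g \<in> linear_maps K W X" "f \<in> linear_maps K V W"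
  shows "(\<lambda>x. g (f x)) \<in> linear_maps K V X"
  using linear_mapsD[OF assms(1)] linear_mapsD[OF assms(2)] by (auto simp: linear_maps_def)

lemma linear_maps_zero:
  assumes "module K X"
  shows "(\<lambda>x. \<zero>\<^bsub>X\<^esub>) \<in> linear_maps K V X"
proof -
  interpret X: module K X by fact
  show ?thesis by (auto simp: linear_maps_def)
qed

lemma linear_maps_add:
  assumes "module K X" "f \<in> linear_maps K V X" "g \<in> linear_maps K V X"
  shows "(\<lambda>x. f x \<oplus>\<^bsub>X\<^esub> g x) \<in> linear_maps K V X"
proof -
  interpret X: module K X by fact
  show ?thesis
    using linear_mapsD[OF assms(2)] linear_mapsD[OF assms(3)]
    by (auto simp: linear_maps_def X.smult_r_distr X.M.a_ac)
qed

lemma linear_maps_finsum: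
  assumes "module K X" "finite I" "\<And>i. i \<in> I \<Longrightarrow> f i \<in> linear_maps K V X"
  shows "(\<lambda>x. \<Oplus>\<^bsub>X\<^esub>i\<in>I. f i x) \<in> linear_maps K V X"
proof -
  interpret X: module K X by fact
  note L = linear_mapsD[OF assms(3)]
  have c: "(\<lambda>i. f i x) \<in> I \<rightarrow> carrier X" if "x \<in> carrier V" for x
    using L(1) that by auto
  show ?thesis
    unfolding linear_maps_def
  proof (intro CollectI conjI ballI funcsetI)
    fix x assume x: "x \<in> carrier V"
    show "(\<Oplus>\<^bsub>X\<^esub>i\<in>I. f i x) \<in> carrier X" using c[OF x] by simp
    fix y assume y: "y \<in> carrier V"
    have "(\<Oplus>\<^bsub>X\<^esub>i\<in>I. f i (x \<oplus>\<^bsub>V\<^esub> y)) = (\<Oplus>\<^bsub>X\<^esub>i\<in>I. f i x \<oplus>\<^bsub>X\<^esub> f i y)"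
      by (rule X.M.finsum_cong'[OF refl]) (use L x y in auto)
    then show "(\<Oplus>\<^bsub>X\<^esub>i\<in>I. f i (x \<oplus>\<^bsub>V\<^esub> y)) = (\<Oplus>\<^bsub>X\<^esub>i\<in>I. f i x) \<oplus>\<^bsub>X\<^esub> (\<Oplus>\<^bsub>X\<^esub>i\<in>I. f i y)"
      using X.M.finsum_addf[OF c[OF x] c[OF y]] by simp
  next
    fix k x assume k: "k \<in> carrier K" and x: "x \<in> carrier V"
    have "(\<Oplus>\<^bsub>X\<^esub>i\<in>I. f i (k \<odot>\<^bsub>V\<^esub> x)) = (\<Oplus>\<^bsub>X\<^esub>i\<in>I. k \<odot>\<^bsub>X\<^esub> f i x)"
      by (rule X.M.finsum_cong'[OF refl]) (use L x k in auto)
    then show "(\<Oplus>\<^bsub>X\<^esub>i\<in>I. f i (k \<odot>\<^bsub>V\<^esub> x)) = k \<odot>\<^bsub>X\<^esub> (\<Oplus>\<^bsub>X\<^esub>i\<in>I. f i x)"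
      using X.finsum_smult_ldistr[OF assms(2) k c[OF x]] by simp
  qed
qed

lemma linear_map_finsum:
  assumes "module K V" "module K W" "f \<in> linear_maps K V W" "finite I" "\<And>i. i \<in> I \<Longrightarrow> g i \<in> carrier V"
  shows "f (\<Oplus>\<^bsub>V\<^esub>i\<in>I. g i) = (\<Oplus>\<^bsub>W\<^esub>i\<in>I. f (g i))"
proof -
  interpret V: module K V by fact
  interpret W: module K W by fact
  note f = linear_mapsD[OF assms(3)]
  show ?thesis
    using assms(4,5)
  proof (induction I rule: finite_induct)
    case empty
    show ?case using linear_maps_zero_minus(1)[OF assms(1-3)] by simp
  next
    case (insert i I)
    have "g \<in> I \<rightarrow> carrier V" "(\<lambda>i. f (g i)) \<in> I \<rightarrow> carrier W"
      using insert.prems f(1) by auto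
    then show ?case using insert f by simp
  qed
qed

lemma bilinear_mapsI:
  assumes "\<And>v. v \<in> carrier V \<Longrightarrow> (\<lambda>w. \<beta> v w) \<in> linear_maps K W X"
    and "\<And>w. w \<in> carrier W \<Longrightarrow> (\<lambda>v. \<beta> v w) \<in> linear_maps K V X"
  shows "\<beta> \<in> bilinear_maps K V W X"
  using assms by (simp add: bilinear_maps_def)

lemma bilinear_mapsD:
  assumes "\<beta> \<in> bilinear_maps K V W X"
  shows "v \<in> carrier V \<Longrightarrow> (\<lambda>w. \<beta> v w) \<in> linear_maps K W X"
    and "w \<in> carrier W \<Longrightarrow> (\<lambda>v. \<beta> v w) \<in> linear_maps K V X"
    and "\<lbrakk>v \<in> carrier V; w \<in> carrier W\<rbrakk> \<Longrightarrow> \<beta> v w \<in> carrier X"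
  using assms by (auto simp: bilinear_maps_def linear_maps_def)

lemma bilinear_maps_compose:
  assumes "\<beta> \<in> bilinear_maps K V W X" "f \<in> linear_maps K V' V" "g \<in> linear_maps K W' W"
  shows "(\<lambda>v w. \<beta> (f v) (g w)) \<in> bilinear_maps K V' W' X"
  by (rule bilinear_mapsI,
      rule linear_maps_compose[OF bilinear_mapsD(1)[OF assms(1) linear_mapsD(1)[OF assms(2)]] assms(3)],
      assumption,
      rule linear_maps_compose[OF bilinear_mapsD(2)[OF assms(1) linear_mapsD(1)[OF assms(3)]] assms(2)])

lemma bilinear_maps_swap:
  assumes "\<beta> \<in> bilinear_maps K V W X"
  shows "(\<lambda>w v. \<beta> v w) \<in> bilinear_maps K W V X"
  using assms by (simp add: bilinear_maps_def)

lemma linear_compose_bilinear: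
  assumes "f \<in> linear_maps K X Y" "\<beta> \<in> bilinear_maps K V W X"
  shows "(\<lambda>v w. f (\<beta> v w)) \<in> bilinear_maps K V W Y"
  by (rule bilinear_mapsI)
     (rule linear_maps_compose[OF assms(1)], erule bilinear_mapsD[OF assms(2)])+

lemma bilinear_maps_finsum:
  assumes "module K X" "finite I" "\<And>i. i \<in> I \<Longrightarrow> \<beta> i \<in> bilinear_maps K V W X"
  shows "(\<lambda>v w. \<Oplus>\<^bsub>X\<^esub>i\<in>I. \<beta> i v w) \<in> bilinear_maps K V W X"
  by (rule bilinear_mapsI; rule linear_maps_finsum[OF assms(1,2)]; rule bilinear_mapsD[OF assms(3)])

text \<open>The second argument is expanded first, which is why its index \<open>j\<close> runs in
  the outer sum.\<close>

lemma bilinear_map_finsum: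
  assumes V: "module K V" and W: "module K W" and X: "module K X" and \<beta>: "\<beta> \<in> bilinear_maps K V W X"
    and "finite I" "finite J" "\<And>i. i \<in> I \<Longrightarrow> v i \<in> carrier V" "\<And>j. j \<in> J \<Longrightarrow> w j \<in> carrier W"
  shows "\<beta> (\<Oplus>\<^bsub>V\<^esub>i\<in>I. v i) (\<Oplus>\<^bsub>W\<^esub>j\<in>J. w j) = (\<Oplus>\<^bsub>X\<^esub>j\<in>J. \<Oplus>\<^bsub>X\<^esub>i\<in>I. \<beta> (v i) (w j))"
proof -
  interpret V: module K V by fact
  interpret X: module K X by fact
  have "(\<Oplus>\<^bsub>V\<^esub>i\<in>I. v i) \<in> carrier V" using assms(7) by (intro V.M.finsum_closed) auto
  then have "\<beta> (\<Oplus>\<^bsub>V\<^esub>i\<in>I. v i) (\<Oplus>\<^bsub>W\<^esub>j\<in>J. w j) = (\<Oplus>\<^bsub>X\<^esub>j\<in>J. \<beta> (\<Oplus>\<^bsub>V\<^esub>i\<in>I. v i) (w j))"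
    by (intro linear_map_finsum[OF W X bilinear_mapsD(1)[OF \<beta>] assms(6,8)])
  also have "\<dots> = (\<Oplus>\<^bsub>X\<^esub>j\<in>J. \<Oplus>\<^bsub>X\<^esub>i\<in>I. \<beta> (v i) (w j))"
  proof (rule X.M.finsum_cong'[OF refl])
    show "(\<lambda>j. \<Oplus>\<^bsub>X\<^esub>i\<in>I. \<beta> (v i) (w j)) \<in> J \<rightarrow> carrier X"
      using assms(7,8) by (auto intro!: X.M.finsum_closed bilinear_mapsD(3)[OF \<beta>])
    show "\<beta> (\<Oplus>\<^bsub>V\<^esub>i\<in>I. v i) (w j) = (\<Oplus>\<^bsub>X\<^esub>i\<in>I. \<beta> (v i) (w j))" if "j \<in> J" for j
      by (rule linear_map_finsum[OF V X bilinear_mapsD(2)[OF \<beta> assms(8)[OF that]] assms(5,7)])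
  qed
  finally show ?thesis .
qed


section \<open>Maps out of tensor products\<close>

text \<open>Uniqueness half of the universal property: by \<open>tensor_induct\<close> the pure
  tensors generate additively. Most identities below are reduced to pure tensors by this
  rule.\<close>

lemma tensor_linear_eqI:
  assumes "module K V" "module K W" "module K X"
    and f: "f \<in> linear_maps K (tensor K V W) X" and g: "g \<in> linear_maps K (tensor K V W) X"
    and "\<And>v w. \<lbrakk>v \<in> carrier V; w \<in> carrier W\<rbrakk> \<Longrightarrow> f (pure_tensor K V W v w) = g (pure_tensor K V W v w)"
    and "x \<in> carrier (tensor K V W)"
  shows "f x = g x"
  using assms(1,2,7)
proof (induction rule: tensor_induct)
  case zero
  show ?case
    using linear_maps_zero_minus(1)[OF tensor_module[OF assms(1,2)] assms(3) f]
      linear_maps_zero_minus(1)[OF tensor_module[OF assms(1,2)] assms(3) g] by simp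
next
  case (add x y)
  then show ?case by (simp add: linear_mapsD(2)[OF f] linear_mapsD(2)[OF g])
qed (rule assms(6))

lemma tensor_bilinear_eqI:
  assumes "module K U" "module K V" "module K W" "module K X"
    and "\<beta> \<in> bilinear_maps K (tensor K U V) W X" "\<gamma> \<in> bilinear_maps K (tensor K U V) W X"
    and "\<And>u v w. \<lbrakk>u \<in> carrier U; v \<in> carrier V; w \<in> carrier W\<rbrakk> \<Longrightarrow>
      \<beta> (pure_tensor K U V u v) w = \<gamma> (pure_tensor K U V u v) w"
    and "x \<in> carrier (tensor K U V)" "w \<in> carrier W"
  shows "\<beta> x w = \<gamma> x w"
  by (rule tensor_linear_eqI[OF assms(1,2,4) bilinear_mapsD(2)[OF assms(5,9)]
      bilinear_mapsD(2)[OF assms(6,9)] assms(7) assms(8)]) (use assms(9) in auto)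

text \<open>The product in \<open>tensor\<close> is defined by lifts into
  \<open>tensor_space\<close>. A lift sees only the module operations, on which the two structures
  agree.\<close>

lemma tensor_lift_space: "tensor_lift K (tensor_space K V W) = tensor_lift K (tensor K V W)"
  by (simp add: tensor_lift_def fun_eq_iff finsum_def tensor_simps)

text \<open>The tensor \<open>y\<close> is fixed and the kernel varies with \<open>u\<close>.
  Induction on \<open>y\<close> works because linear maps contain zero and are closed under sums,
  and on a pure tensor the lift is \<open>\<beta> u v w\<close>. This makes nested lifts linear in
  the outer variable.\<close>

lemma tensor_lift_linear_param:
  assumes K: "field K" and U: "module K U" and V: "module K V" and W: "module K W" and X: "module K X"
    and b: "\<And>u. u \<in> carrier U \<Longrightarrow> \<beta> u \<in> bilinear_maps K V W X"
    and l: "\<And>v w. \<lbrakk>v \<in> carrier V; w \<in> carrier W\<rbrakk> \<Longrightarrow> (\<lambda>u. \<beta> u v w) \<in> linear_maps K U X"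
    and "y \<in> carrier (tensor K V W)"
  shows "(\<lambda>u. tensor_lift K X (\<beta> u) y) \<in> linear_maps K U X"
  using V W assms(8)
proof (induction rule: tensor_induct)
  case zero
  show ?case
    by (rule linear_maps_cong[OF U linear_maps_zero[OF X]])
       (rule linear_maps_zero_minus(1)[OF tensor_module[OF V W] X tensor_lift_linear[OF K V W X b]])
next
  case (pure v w)
  show ?case
    by (rule linear_maps_cong[OF U l[OF pure]]) (rule tensor_lift_pure[OF K V W X b pure])
next
  case (add x y)
  show ?case
    by (rule linear_maps_cong[OF U linear_maps_add[OF X add(3,4)]])
       (rule linear_mapsD(2)[OF tensor_lift_linear[OF K V W X b] add(1,2)])
qed

lemma tensor_lift_bilinear_left:
  assumes K: "field K" and U: "module K U" and V: "module K V" and W: "module K W" and X: "module K X"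
    and b: "\<And>w. w \<in> carrier W \<Longrightarrow> (\<lambda>u v. T u v w) \<in> bilinear_maps K U V X"
    and l: "\<And>u v. \<lbrakk>u \<in> carrier U; v \<in> carrier V\<rbrakk> \<Longrightarrow> (\<lambda>w. T u v w) \<in> linear_maps K W X"
  shows "(\<lambda>x w. tensor_lift K X (\<lambda>u v. T u v w) x) \<in> bilinear_maps K (tensor K U V) W X"
  by (rule bilinear_mapsI)
     (rule tensor_lift_linear_param[OF K W U V X b l], assumption+,
      rule tensor_lift_linear[OF K U V X b], assumption)

lemma tensor_lift_bilinear_right:
  assumes K: "field K" and U: "module K U" and V: "module K V" and W: "module K W" and X: "module K X"
    and b: "\<And>u. u \<in> carrier U \<Longrightarrow> (\<lambda>v w. T u v w) \<in> bilinear_maps K V W X"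
    and l: "\<And>v w. \<lbrakk>v \<in> carrier V; w \<in> carrier W\<rbrakk> \<Longrightarrow> (\<lambda>u. T u v w) \<in> linear_maps K U X"
  shows "(\<lambda>u y. tensor_lift K X (\<lambda>v w. T u v w) y) \<in> bilinear_maps K U (tensor K V W) X"
  by (rule bilinear_mapsI)
     (rule tensor_lift_linear[OF K V W X b], assumption,
      rule tensor_lift_linear_param[OF K U V W X b l], assumption+)

lemma tensor_map_linear:
  assumes K: "field K" and "module K V'" "module K W'" and V: "module K V" and W: "module K W"
    and "f \<in> linear_maps K V' V" "g \<in> linear_maps K W' W"
  shows "tensor_map K V W f g \<in> linear_maps K (tensor K V' W') (tensor K V W)"
  unfolding tensor_map_def
  by (rule tensor_lift_linear[OF K assms(2,3) tensor_module[OF V W]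
        bilinear_maps_compose[OF pure_tensor_bilinear[OF V W] assms(6,7)]])

lemma tensor_map_pure:
  assumes K: "field K" and "module K V'" "module K W'" and V: "module K V" and W: "module K W"
    and "f \<in> linear_maps K V' V" "g \<in> linear_maps K W' W" "v \<in> carrier V'" "w \<in> carrier W'"
  shows "tensor_map K V W f g (pure_tensor K V' W' v w) = pure_tensor K V W (f v) (g w)"
  unfolding tensor_map_def
  by (rule tensor_lift_pure[OF K assms(2,3) tensor_module[OF V W]
        bilinear_maps_compose[OF pure_tensor_bilinear[OF V W] assms(6,7)] assms(8,9)])

lemma tensor_flip_linear:
  assumes K: "field K" and V: "module K V" and W: "module K W"
  shows "tensor_flip K V W \<in> linear_maps K (tensor K V W) (tensor K W V)"
  unfolding tensor_flip_def
  by (rule tensor_lift_linear[OF K V W tensor_module[OF W V]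
        bilinear_maps_swap[OF pure_tensor_bilinear[OF W V]]])

lemma tensor_flip_pure:
  assumes K: "field K" and V: "module K V" and W: "module K W" and "v \<in> carrier V" "w \<in> carrier W"
  shows "tensor_flip K V W (pure_tensor K V W v w) = pure_tensor K W V w v"
  unfolding tensor_flip_def
  by (rule tensor_lift_pure[OF K V W tensor_module[OF W V]
        bilinear_maps_swap[OF pure_tensor_bilinear[OF W V]] assms(4,5)])

lemma tensor_flip_flip:
  assumes K: "field K" and V: "module K V" and W: "module K W" and "x \<in> carrier (tensor K V W)"
  shows "tensor_flip K W V (tensor_flip K V W x) = x"
  by (rule tensor_linear_eqI[OF V W tensor_module[OF V W]
        linear_maps_compose[OF tensor_flip_linear[OF K W V] tensor_flip_linear[OF K V W]]
        linear_maps_ident _ assms(4)])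
     (simp add: tensor_flip_pure[OF K] V W)

section \<open>The associativity isomorphism and threefold tensor products\<close>

context
  fixes K and U and V and W
  assumes K: "field K" and U: "module K U" and V: "module K V" and W: "module K W"
begin

private lemmas UV = tensor_module[OF U V] and VW = tensor_module[OF V W]
private lemmas U_VW = tensor_module[OF U VW] and UV_W = tensor_module[OF UV W]
private lemmas puv = pure_tensor_bilinear[OF U V] and pvw = pure_tensor_bilinear[OF V W]
private lemmas pu_vw = pure_tensor_bilinear[OF U VW] and puv_w = pure_tensor_bilinear[OF UV W]

text \<open>\<open>tensor_assoc\<close> is a lift inside a lift, so its evaluation takes bilinearity
  twice: of the inner kernel for fixed \<open>w\<close>, and of the lifted map in \<open>x\<close>
  and \<open>w\<close>.\<close>

private lemma assoc_bilinear:
  "(\<lambda>x w. tensor_lift K (tensor K U (tensor K V W))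
      (\<lambda>u v. pure_tensor K U (tensor K V W) u (pure_tensor K V W v w)) x)
    \<in> bilinear_maps K (tensor K U V) W (tensor K U (tensor K V W))"
  and assoc_inner: "w \<in> carrier W \<Longrightarrow>
    (\<lambda>u v. pure_tensor K U (tensor K V W) u (pure_tensor K V W v w))
      \<in> bilinear_maps K U V (tensor K U (tensor K V W))"
proof -
  show i: "(\<lambda>u v. pure_tensor K U (tensor K V W) u (pure_tensor K V W v w))
      \<in> bilinear_maps K U V (tensor K U (tensor K V W))" if "w \<in> carrier W" for w
    by (rule bilinear_maps_compose[OF pu_vw linear_maps_ident bilinear_mapsD(2)[OF pvw that]])
  show "(\<lambda>x w. tensor_lift K (tensor K U (tensor K V W))
      (\<lambda>u v. pure_tensor K U (tensor K V W) u (pure_tensor K V W v w)) x)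
    \<in> bilinear_maps K (tensor K U V) W (tensor K U (tensor K V W))"
    by (rule tensor_lift_bilinear_left[OF K U V W U_VW i])
       (assumption, rule linear_maps_compose[OF bilinear_mapsD(1)[OF pu_vw] bilinear_mapsD(1)[OF pvw]])
qed

private lemma assoc_inv_bilinear:
  "(\<lambda>u y. tensor_lift K (tensor K (tensor K U V) W)
      (\<lambda>v w. pure_tensor K (tensor K U V) W (pure_tensor K U V u v) w) y)
    \<in> bilinear_maps K U (tensor K V W) (tensor K (tensor K U V) W)"
  and assoc_inv_inner: "u \<in> carrier U \<Longrightarrow>
    (\<lambda>v w. pure_tensor K (tensor K U V) W (pure_tensor K U V u v) w)
      \<in> bilinear_maps K V W (tensor K (tensor K U V) W)"
proof -
  show i: "(\<lambda>v w. pure_tensor K (tensor K U V) W (pure_tensor K U V u v) w)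
      \<in> bilinear_maps K V W (tensor K (tensor K U V) W)" if "u \<in> carrier U" for u
    by (rule bilinear_maps_compose[OF puv_w bilinear_mapsD(1)[OF puv that] linear_maps_ident])
  show "(\<lambda>u y. tensor_lift K (tensor K (tensor K U V) W)
      (\<lambda>v w. pure_tensor K (tensor K U V) W (pure_tensor K U V u v) w) y)
    \<in> bilinear_maps K U (tensor K V W) (tensor K (tensor K U V) W)"
    by (rule tensor_lift_bilinear_right[OF K U V W UV_W i])
       (assumption, rule linear_maps_compose[OF bilinear_mapsD(2)[OF puv_w] bilinear_mapsD(2)[OF puv]])
qed

lemma tensor_assoc_linear:
  "tensor_assoc K U V W \<in> linear_maps K (tensor K (tensor K U V) W) (tensor K U (tensor K V W))"
  unfolding tensor_assoc_def by (rule tensor_lift_linear[OF K UV W U_VW assoc_bilinear])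

lemma tensor_assoc_inv_linear:
  "tensor_assoc_inv K U V W \<in> linear_maps K (tensor K U (tensor K V W)) (tensor K (tensor K U V) W)"
  unfolding tensor_assoc_inv_def by (rule tensor_lift_linear[OF K U VW UV_W assoc_inv_bilinear])

lemma tensor_assoc_pure:
  assumes "u \<in> carrier U" "v \<in> carrier V" "w \<in> carrier W"
  shows "tensor_assoc K U V W (pure_tensor K (tensor K U V) W (pure_tensor K U V u v) w)
    = pure_tensor K U (tensor K V W) u (pure_tensor K V W v w)"
  unfolding tensor_assoc_def
  by (subst tensor_lift_pure[OF K UV W U_VW assoc_bilinear bilinear_mapsD(3)[OF puv assms(1,2)] assms(3)])
     (rule tensor_lift_pure[OF K U V U_VW assoc_inner[OF assms(3)] assms(1,2)])

lemma tensor_assoc_inv_pure: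
  assumes "u \<in> carrier U" "v \<in> carrier V" "w \<in> carrier W"
  shows "tensor_assoc_inv K U V W (pure_tensor K U (tensor K V W) u (pure_tensor K V W v w))
    = pure_tensor K (tensor K U V) W (pure_tensor K U V u v) w"
  unfolding tensor_assoc_inv_def
  by (subst tensor_lift_pure[OF K U VW UV_W assoc_inv_bilinear assms(1) bilinear_mapsD(3)[OF pvw assms(2,3)]])
     (rule tensor_lift_pure[OF K V W UV_W assoc_inv_inner[OF assms(1)] assms(2,3)])

lemma tensor3_linear_eqI:
  assumes X: "module K X"
    and f: "f \<in> linear_maps K (tensor K (tensor K U V) W) X"
    and g: "g \<in> linear_maps K (tensor K (tensor K U V) W) X"
    and "\<And>u v w. \<lbrakk>u \<in> carrier U; v \<in> carrier V; w \<in> carrier W\<rbrakk> \<Longrightarrow>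
      f (pure_tensor K (tensor K U V) W (pure_tensor K U V u v) w)
        = g (pure_tensor K (tensor K U V) W (pure_tensor K U V u v) w)"
    and x: "x \<in> carrier (tensor K (tensor K U V) W)"
  shows "f x = g x"
proof (rule tensor_linear_eqI[OF UV W X f g _ x])
  fix y w assume y: "y \<in> carrier (tensor K U V)" and w: "w \<in> carrier W"
  show "f (pure_tensor K (tensor K U V) W y w) = g (pure_tensor K (tensor K U V) W y w)"
    by (rule tensor_bilinear_eqI[OF U V W X linear_compose_bilinear[OF f puv_w]
          linear_compose_bilinear[OF g puv_w] assms(4) y w])
qed

text \<open>Rebracketed elements \<open>u \<otimes> q\<close> also generate, since pure
  \<open>q\<close> already yields every \<open>(u \<otimes> v) \<otimes> w\<close>. Testing on them
  leaves \<open>q\<close> undecomposed, which is the form of \<open>hexagon_right\<close>.\<close>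

lemma tensor3_linear_eqI':
  assumes X: "module K X"
    and f: "f \<in> linear_maps K (tensor K (tensor K U V) W) X"
    and g: "g \<in> linear_maps K (tensor K (tensor K U V) W) X"
    and "\<And>u q. \<lbrakk>u \<in> carrier U; q \<in> carrier (tensor K V W)\<rbrakk> \<Longrightarrow>
      f (tensor_assoc_inv K U V W (pure_tensor K U (tensor K V W) u q))
        = g (tensor_assoc_inv K U V W (pure_tensor K U (tensor K V W) u q))"
    and x: "x \<in> carrier (tensor K (tensor K U V) W)"
  shows "f x = g x"
proof (rule tensor3_linear_eqI[OF X f g _ x])
  fix u v w assume "u \<in> carrier U" "v \<in> carrier V" "w \<in> carrier W"
  then show "f (pure_tensor K (tensor K U V) W (pure_tensor K U V u v) w)
      = g (pure_tensor K (tensor K U V) W (pure_tensor K U V u v) w)"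
    using assms(4)[OF _ bilinear_mapsD(3)[OF pvw]] by (metis tensor_assoc_inv_pure)
qed

lemma tensor_assoc_assoc_inv:
  assumes "y \<in> carrier (tensor K U (tensor K V W))"
  shows "tensor_assoc K U V W (tensor_assoc_inv K U V W y) = y"
proof -
  note c = linear_maps_compose[OF tensor_assoc_linear tensor_assoc_inv_linear]
  have "tensor_assoc K U V W (tensor_assoc_inv K U V W (pure_tensor K U (tensor K V W) u q))
      = pure_tensor K U (tensor K V W) u q" if u: "u \<in> carrier U" and q: "q \<in> carrier (tensor K V W)" for u q
    by (rule tensor_linear_eqI[OF V W U_VW linear_maps_compose[OF c bilinear_mapsD(1)[OF pu_vw u]]
          bilinear_mapsD(1)[OF pu_vw u] _ q])
       (simp add: tensor_assoc_pure tensor_assoc_inv_pure u)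
  then show ?thesis
    by (rule tensor_linear_eqI[OF U VW U_VW c linear_maps_ident _ assms])
qed

end


section \<open>The tensor product of two bilinear maps\<close>

text \<open>The map \<open>(a \<otimes> b, c \<otimes> d) \<mapsto> \<beta> a c \<otimes> \<gamma> b
  d\<close>. It has the shape of the product in \<open>tensor\<close>, so that the product of
  \<open>H \<otimes> H\<close> and its factorwise action on \<open>A \<otimes> A\<close> are
  instances of one construction.\<close>

definition tensor_bilinear where
  "tensor_bilinear K V W \<beta> \<gamma> x y = tensor_lift K (tensor K V W)
     (\<lambda>a b. tensor_lift K (tensor K V W) (\<lambda>c d. pure_tensor K V W (\<beta> a c) (\<gamma> b d)) y) x"

context
  fixes K and V and V' and V'' and W and W' and W'' and \<beta> and \<gamma>
  assumes K: "field K" and V: "module K V" and V': "module K V'" and V'': "module K V''"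
    and W: "module K W" and W': "module K W'" and W'': "module K W''"
    and \<beta>: "\<beta> \<in> bilinear_maps K V V' V''" and \<gamma>: "\<gamma> \<in> bilinear_maps K W W' W''"
begin

private lemmas T = tensor_module[OF V'' W''] and p = pure_tensor_bilinear[OF V'' W'']

private lemma inner_bilinear:
  "\<lbrakk>a \<in> carrier V; b \<in> carrier W\<rbrakk> \<Longrightarrow>
    (\<lambda>c d. pure_tensor K V'' W'' (\<beta> a c) (\<gamma> b d)) \<in> bilinear_maps K V' W' (tensor K V'' W'')"
  by (rule bilinear_maps_compose[OF p bilinear_mapsD(1)[OF \<beta>] bilinear_mapsD(1)[OF \<gamma>]])

text \<open>As \<open>y\<close> is an arbitrary tensor, the inner lift cannot be evaluated;
  linearity in \<open>a\<close> and in \<open>b\<close> comes from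
  \<open>tensor_lift_linear_param\<close>.\<close>

private lemma outer_bilinear:
  assumes "y \<in> carrier (tensor K V' W')"
  shows "(\<lambda>a b. tensor_lift K (tensor K V'' W'') (\<lambda>c d. pure_tensor K V'' W'' (\<beta> a c) (\<gamma> b d)) y)
    \<in> bilinear_maps K V W (tensor K V'' W'')"
proof (rule bilinear_mapsI)
  fix a assume a: "a \<in> carrier V"
  show "(\<lambda>b. tensor_lift K (tensor K V'' W'') (\<lambda>c d. pure_tensor K V'' W'' (\<beta> a c) (\<gamma> b d)) y)
    \<in> linear_maps K W (tensor K V'' W'')"
    by (rule tensor_lift_linear_param[OF K W V' W' T inner_bilinear[OF a] _ assms])
       (assumption, rule linear_maps_compose[OF bilinear_mapsD(1)[OF p bilinear_mapsD(3)[OF \<beta> a]] bilinear_mapsD(2)[OF \<gamma>]])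
next
  fix b assume b: "b \<in> carrier W"
  show "(\<lambda>a. tensor_lift K (tensor K V'' W'') (\<lambda>c d. pure_tensor K V'' W'' (\<beta> a c) (\<gamma> b d)) y)
    \<in> linear_maps K V (tensor K V'' W'')"
    by (rule tensor_lift_linear_param[OF K V V' W' T inner_bilinear[OF _ b] _ assms])
       (assumption, rule linear_maps_compose[OF bilinear_mapsD(2)[OF p bilinear_mapsD(3)[OF \<gamma> b]] bilinear_mapsD(2)[OF \<beta>]])
qed

lemma tensor_bilinear_bilinear:
  "tensor_bilinear K V'' W'' \<beta> \<gamma>
    \<in> bilinear_maps K (tensor K V W) (tensor K V' W') (tensor K V'' W'')"
  unfolding tensor_bilinear_def[abs_def]
  by (rule tensor_lift_bilinear_left[OF K V W tensor_module[OF V' W'] T outer_bilinear])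
     (assumption, rule tensor_lift_linear[OF K V' W' T inner_bilinear])

lemma tensor_bilinear_pure:
  assumes "v \<in> carrier V" "w \<in> carrier W" "v' \<in> carrier V'" "w' \<in> carrier W'"
  shows "tensor_bilinear K V'' W'' \<beta> \<gamma> (pure_tensor K V W v w) (pure_tensor K V' W' v' w')
    = pure_tensor K V'' W'' (\<beta> v v') (\<gamma> w w')"
  unfolding tensor_bilinear_def
  by (subst tensor_lift_pure[OF K V W T outer_bilinear[OF pure_tensor_closed[OF V' assms(3,4)]] assms(1,2)])
     (rule tensor_lift_pure[OF K V' W' T inner_bilinear[OF assms(1,2)] assms(3,4)])

end

text \<open>Bilinearity and the formula on pure tensors thus pass to the product of
  \<open>H \<otimes> H\<close> and, with that product as one factor, to that of
  \<open>tensor3 K H\<close>.\<close>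

lemma mult_tensor: "mult (tensor K V W) = tensor_bilinear K V W (mult V) (mult W)"
  by (simp add: tensor_bilinear_def fun_eq_iff flip: tensor_lift_space) (simp add: tensor_def)

lemma one_tensor: "\<one>\<^bsub>tensor K V W\<^esub> = pure_tensor K V W \<one>\<^bsub>V\<^esub> \<one>\<^bsub>W\<^esub>"
  by (simp add: tensor_def)

lemma unital_algebra_mult_bilinear:
  assumes "unital_algebra K A"
  shows "mult A \<in> bilinear_maps K A A A"
proof -
  interpret unital_algebra K A by fact
  show ?thesis
    by (rule bilinear_mapsI)
       (simp_all add: linear_maps_def A.l_distr A.r_distr smult_mult_left smult_mult_right)
qed


section \<open>The braiding of a module-algebra\<close>

definition R_matrix_braiding where
  "R_matrix_braiding K A act I s t = tensor_lift K (tensor K A A)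
     (\<lambda>a b. \<Oplus>\<^bsub>tensor K A A\<^esub>i\<in>I. pure_tensor K A A (act (t i) b) (act (s i) a))"

context
  fixes K :: "('k, 'r) ring_scheme"
    and H :: "('k, 'h, 'm) module_scheme"
    and A :: "('k, 'a, 'n) module_scheme"
    and \<Delta> \<epsilon> S R act
    and I :: "'i set" and s t :: "'i \<Rightarrow> 'h"
  assumes qt: "quasi_triangular_hopf_algebra K H \<Delta> \<epsilon> S R"
    and ma: "module_algebra K H \<Delta> \<epsilon> S A act"
    and I: "finite I" and s: "s \<in> I \<rightarrow> carrier H" and t: "t \<in> I \<rightarrow> carrier H"
    and R: "R = (\<Oplus>\<^bsub>tensor K H H\<^esub>i\<in>I. pure_tensor K H H (s i) (t i))"
begin

section \<open>Standing facts on the Hopf algebra and the module-algebra\<close>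

private lemmas H_hopf = quasi_triangular_hopf_algebra.axioms(1)[OF qt]
private lemmas H_alg = hopf_algebra.axioms(1)[OF H_hopf]
private lemmas A_alg = module_algebra.axioms(2)[OF ma]
private lemmas K = unital_algebra.axioms(1)[OF H_alg]
private lemmas H = unital_algebra.axioms(2)[OF H_alg]
private lemmas A = unital_algebra.axioms(2)[OF A_alg]
private lemmas HH = tensor_module[OF H H] and AA = tensor_module[OF A A]
private lemmas HHH = tensor_module[OF HH H] and AAA = tensor_module[OF AA A]
private lemmas A_AA = tensor_module[OF A AA]
private lemmas pHH = pure_tensor_bilinear[OF H H] and pAA = pure_tensor_bilinear[OF A A]
private lemmas pHHH = pure_tensor_bilinear[OF HH H] and pAAA = pure_tensor_bilinear[OF AA A]
private lemmas pA_AA = pure_tensor_bilinear[OF A AA]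
private lemmas act = module_algebra.act_bilinear[OF ma]
private lemmas mH = unital_algebra_mult_bilinear[OF H_alg]
private lemmas mA = unital_algebra_mult_bilinear[OF A_alg]
private lemmas comult = hopf_algebra.comult_linear[OF H_hopf]

private lemma one_H: "\<one>\<^bsub>H\<^esub> \<in> carrier H" and one_A: "\<one>\<^bsub>A\<^esub> \<in> carrier A"
  and mult_one_H: "x \<in> carrier H \<Longrightarrow> \<one>\<^bsub>H\<^esub> \<otimes>\<^bsub>H\<^esub> x = x" "x \<in> carrier H \<Longrightarrow> x \<otimes>\<^bsub>H\<^esub> \<one>\<^bsub>H\<^esub> = x"
  and mult_one_A: "\<one>\<^bsub>A\<^esub> \<otimes>\<^bsub>A\<^esub> \<one>\<^bsub>A\<^esub> = \<one>\<^bsub>A\<^esub>"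
proof -
  interpret H: ring H by (rule unital_algebra.axioms(3)[OF H_alg])
  interpret A: ring A by (rule unital_algebra.axioms(3)[OF A_alg])
  show "\<one>\<^bsub>H\<^esub> \<in> carrier H" "\<one>\<^bsub>A\<^esub> \<in> carrier A" "\<one>\<^bsub>A\<^esub> \<otimes>\<^bsub>A\<^esub> \<one>\<^bsub>A\<^esub> = \<one>\<^bsub>A\<^esub>"
    "x \<in> carrier H \<Longrightarrow> \<one>\<^bsub>H\<^esub> \<otimes>\<^bsub>H\<^esub> x = x" "x \<in> carrier H \<Longrightarrow> x \<otimes>\<^bsub>H\<^esub> \<one>\<^bsub>H\<^esub> = x"
    by simp_all
qed

private lemma st: "i \<in> I \<Longrightarrow> s i \<in> carrier H" "i \<in> I \<Longrightarrow> t i \<in> carrier H"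
  using s t by auto

private lemma act_closed: "\<lbrakk>h \<in> carrier H; a \<in> carrier A\<rbrakk> \<Longrightarrow> act h a \<in> carrier A"
  by (rule bilinear_mapsD(3)[OF act])

private lemma R_carrier: "R \<in> carrier (tensor K H H)"
  using quasi_triangular_hopf_algebra.R_invertible[OF qt] by (simp add: Units_def)

section \<open>The braiding as the action of \<open>R\<close> followed by the flip\<close>

private abbreviation "\<sigma> \<equiv> R_matrix_braiding K A act I s t"
private abbreviation "\<tau> \<equiv> tensor_flip K A A"
private abbreviation "\<mu> \<equiv> mult_map K A"
text \<open>\<open>\<Phi>\<close> is the factorwise action of \<open>H \<otimes> H\<close> on
  \<open>A \<otimes> A\<close>; \<open>D\<close> is its pullback along \<open>\<Delta>\<close>, the
  usual action of a Hopf algebra on a tensor product of modules.\<close>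

private abbreviation "\<Phi> \<equiv> tensor_bilinear K A A act act"
private abbreviation "D h \<equiv> \<Phi> (\<Delta> h)"

private lemma \<sigma>_bilinear:
  "(\<lambda>a b. \<Oplus>\<^bsub>tensor K A A\<^esub>i\<in>I. pure_tensor K A A (act (t i) b) (act (s i) a))
    \<in> bilinear_maps K A A (tensor K A A)"
  by (rule bilinear_maps_finsum[OF AA I])
     (rule bilinear_maps_compose[OF bilinear_maps_swap[OF pAA] bilinear_mapsD(1)[OF act] bilinear_mapsD(1)[OF act]];
      rule st; assumption)

private lemma \<sigma>_linear: "\<sigma> \<in> linear_maps K (tensor K A A) (tensor K A A)"
  unfolding R_matrix_braiding_def by (rule tensor_lift_linear[OF K A A AA \<sigma>_bilinear])

private lemma \<sigma>_pure:
  "\<lbrakk>a \<in> carrier A; b \<in> carrier A\<rbrakk> \<Longrightarrow>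
    \<sigma> (pure_tensor K A A a b) = (\<Oplus>\<^bsub>tensor K A A\<^esub>i\<in>I. pure_tensor K A A (act (t i) b) (act (s i) a))"
  unfolding R_matrix_braiding_def by (rule tensor_lift_pure[OF K A A AA \<sigma>_bilinear])

text \<open>Read backwards, this recognises a sum over \<open>I\<close> as a value of
  \<open>\<sigma>\<close>, as the hexagons require.\<close>

private lemma linear_\<sigma>_pure:
  assumes "module K X" "f \<in> linear_maps K (tensor K A A) X" "a \<in> carrier A" "b \<in> carrier A"
  shows "f (\<sigma> (pure_tensor K A A a b)) = (\<Oplus>\<^bsub>X\<^esub>i\<in>I. f (pure_tensor K A A (act (t i) b) (act (s i) a)))"
  unfolding \<sigma>_pure[OF assms(3,4)]
  by (rule linear_map_finsum[OF AA assms(1,2) I]) (intro bilinear_mapsD(3)[OF pAA] act_closed st assms)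

private lemmas \<Phi>_bilinear = tensor_bilinear_bilinear[OF K H A A H A A act act]
private lemmas \<Phi>_pure = tensor_bilinear_pure[OF K H A A H A A act act]
private lemmas HH_mult_bilinear =
  tensor_bilinear_bilinear[OF K H H H H H H mH mH, folded mult_tensor]
private lemmas HH_mult_pure = tensor_bilinear_pure[OF K H H H H H H mH mH, folded mult_tensor]
private lemmas HHH_mult_bilinear =
  tensor_bilinear_bilinear[OF K HH HH HH H H H HH_mult_bilinear mH, folded mult_tensor]
private lemmas HHH_mult_pure =
  tensor_bilinear_pure[OF K HH HH HH H H H HH_mult_bilinear mH, folded mult_tensor]
private lemmas \<tau>_linear = tensor_flip_linear[OF K A A]
private lemmas \<tau>_pure = tensor_flip_pure[OF K A A]

text \<open>When \<open>R\<close> is expanded, the \<open>i\<close>-th summand lets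
  \<open>s i\<close> act on the first factor and \<open>t i\<close> on the second, and the flip
  exchanges them. This trades sums over \<open>I\<close> for algebra with \<open>R\<close>
  itself.\<close>

private lemma \<sigma>_eq:
  assumes "p \<in> carrier (tensor K A A)"
  shows "\<sigma> p = \<tau> (\<Phi> R p)"
proof (rule tensor_linear_eqI[OF A A AA \<sigma>_linear _ _ assms])
  show "(\<lambda>p. \<tau> (\<Phi> R p)) \<in> linear_maps K (tensor K A A) (tensor K A A)"
    by (rule linear_maps_compose[OF \<tau>_linear bilinear_mapsD(1)[OF \<Phi>_bilinear R_carrier]])
  interpret AA: module K "tensor K A A" by (rule AA)
  fix a b assume ab: "a \<in> carrier A" "b \<in> carrier A"
  have "\<tau> (\<Phi> R (pure_tensor K A A a b))
      = (\<Oplus>\<^bsub>tensor K A A\<^esub>i\<in>I. \<tau> (\<Phi> (pure_tensor K H H (s i) (t i)) (pure_tensor K A A a b)))"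
    unfolding R
    by (rule linear_map_finsum[OF HH AA linear_maps_compose[OF \<tau>_linear bilinear_mapsD(2)[OF \<Phi>_bilinear]] I])
       (intro bilinear_mapsD(3)[OF pAA] bilinear_mapsD(3)[OF pHH] ab st; assumption)+
  also have "\<dots> = \<sigma> (pure_tensor K A A a b)"
    unfolding \<sigma>_pure[OF ab]
    by (rule AA.M.finsum_cong'[OF refl])
       (auto simp: \<Phi>_pure \<tau>_pure ab st act_closed intro!: bilinear_mapsD(3)[OF pAA])
  finally show "\<sigma> (pure_tensor K A A a b) = \<tau> (\<Phi> R (pure_tensor K A A a b))" ..
qed

text \<open>On pure tensors this is \<open>act_mult\<close> in each factor. The arguments are made
  pure one at a time: fact \<open>1\<close> reduces \<open>p\<close>, fact \<open>2\<close> reduces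
  \<open>y\<close>, and the conclusion reduces \<open>x\<close>.\<close>

private lemma \<Phi>_mult:
  assumes x: "x \<in> carrier (tensor K H H)" and y: "y \<in> carrier (tensor K H H)"
    and p: "p \<in> carrier (tensor K A A)"
  shows "\<Phi> (x \<otimes>\<^bsub>tensor K H H\<^esub> y) p = \<Phi> x (\<Phi> y p)"
proof -
  note m = HH_mult_bilinear and \<Phi> = \<Phi>_bilinear
  have 1: "\<Phi> (pure_tensor K H H g h \<otimes>\<^bsub>tensor K H H\<^esub> pure_tensor K H H g' h') p
      = \<Phi> (pure_tensor K H H g h) (\<Phi> (pure_tensor K H H g' h') p)"
    if c: "g \<in> carrier H" "h \<in> carrier H" "g' \<in> carrier H" "h' \<in> carrier H" for g h g' h'
  proof (rule tensor_linear_eqI[OF A A AA _ _ _ p])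
    note gh = bilinear_mapsD(3)[OF pHH c(1,2)] and gh' = bilinear_mapsD(3)[OF pHH c(3,4)]
    show "\<Phi> (pure_tensor K H H g h \<otimes>\<^bsub>tensor K H H\<^esub> pure_tensor K H H g' h')
        \<in> linear_maps K (tensor K A A) (tensor K A A)"
      by (rule bilinear_mapsD(1)[OF \<Phi> bilinear_mapsD(3)[OF m gh gh']])
    show "(\<lambda>p. \<Phi> (pure_tensor K H H g h) (\<Phi> (pure_tensor K H H g' h') p))
        \<in> linear_maps K (tensor K A A) (tensor K A A)"
      by (rule linear_maps_compose[OF bilinear_mapsD(1)[OF \<Phi> gh] bilinear_mapsD(1)[OF \<Phi> gh']])
    fix a b assume "a \<in> carrier A" "b \<in> carrier A"
    then show "\<Phi> (pure_tensor K H H g h \<otimes>\<^bsub>tensor K H H\<^esub> pure_tensor K H H g' h') (pure_tensor K A A a b)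
        = \<Phi> (pure_tensor K H H g h) (\<Phi> (pure_tensor K H H g' h') (pure_tensor K A A a b))"
      using c by (simp add: HH_mult_pure \<Phi>_pure act_closed bilinear_mapsD(3)[OF mH]
          module_algebra.act_mult[OF ma])
  qed
  have 2: "\<Phi> (pure_tensor K H H g h \<otimes>\<^bsub>tensor K H H\<^esub> y) p = \<Phi> (pure_tensor K H H g h) (\<Phi> y p)"
    if c: "g \<in> carrier H" "h \<in> carrier H" for g h
  proof -
    note gh = bilinear_mapsD(3)[OF pHH c]
    show ?thesis
      by (rule tensor_linear_eqI[OF H H AA
            linear_maps_compose[OF bilinear_mapsD(2)[OF \<Phi> p] bilinear_mapsD(1)[OF m gh]]
            linear_maps_compose[OF bilinear_mapsD(1)[OF \<Phi> gh] bilinear_mapsD(2)[OF \<Phi> p]] 1[OF c] y])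
  qed
  show ?thesis
    by (rule tensor_linear_eqI[OF H H AA
          linear_maps_compose[OF bilinear_mapsD(2)[OF \<Phi> p] bilinear_mapsD(2)[OF m y]]
          bilinear_mapsD(2)[OF \<Phi> bilinear_mapsD(3)[OF \<Phi> y p]] 2 x])
qed

private lemma \<Phi>_one:
  assumes "p \<in> carrier (tensor K A A)"
  shows "\<Phi> \<one>\<^bsub>tensor K H H\<^esub> p = p"
  unfolding one_tensor
  by (rule tensor_linear_eqI[OF A A AA
        bilinear_mapsD(1)[OF \<Phi>_bilinear bilinear_mapsD(3)[OF pHH one_H one_H]] linear_maps_ident _ assms])
     (simp add: \<Phi>_pure one_H module_algebra.act_one[OF ma])

text \<open>Exchanging the factors of \<open>A \<otimes> A\<close> exchanges those of the acting
  element. In \<open>\<sigma>_D\<close> this turns the opposite coproduct back into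
  \<open>\<Delta>\<close>.\<close>

private lemma \<tau>_\<Phi>:
  assumes x: "x \<in> carrier (tensor K H H)" and p: "p \<in> carrier (tensor K A A)"
  shows "\<tau> (\<Phi> x p) = \<Phi> (tensor_flip K H H x) (\<tau> p)"
proof -
  note \<Phi> = \<Phi>_bilinear and fl = tensor_flip_linear[OF K H H]
  have 1: "\<tau> (\<Phi> (pure_tensor K H H g h) p) = \<Phi> (tensor_flip K H H (pure_tensor K H H g h)) (\<tau> p)"
    if c: "g \<in> carrier H" "h \<in> carrier H" for g h
  proof -
    note gh = bilinear_mapsD(3)[OF pHH c]
    show ?thesis
      by (rule tensor_linear_eqI[OF A A AA
            linear_maps_compose[OF \<tau>_linear bilinear_mapsD(1)[OF \<Phi> gh]]
            linear_maps_compose[OF bilinear_mapsD(1)[OF \<Phi> linear_mapsD(1)[OF fl gh]] \<tau>_linear] _ p])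
         (simp add: \<Phi>_pure \<tau>_pure tensor_flip_pure[OF K H H] c act_closed)
  qed
  show ?thesis
    by (rule tensor_linear_eqI[OF H H AA
          linear_maps_compose[OF \<tau>_linear bilinear_mapsD(2)[OF \<Phi> p]]
          linear_maps_compose[OF bilinear_mapsD(2)[OF \<Phi> linear_mapsD(1)[OF \<tau>_linear p]] fl] 1 x])
qed

private lemma comult_closed: "h \<in> carrier H \<Longrightarrow> \<Delta> h \<in> carrier (tensor K H H)"
  by (rule linear_mapsD(1)[OF comult])

private lemma D_bilinear: "D \<in> bilinear_maps K H (tensor K A A) (tensor K A A)"
  by (rule bilinear_maps_compose[OF \<Phi>_bilinear comult linear_maps_ident])

private lemma \<sigma>_D:
  assumes h: "h \<in> carrier H" and p: "p \<in> carrier (tensor K A A)"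
  shows "\<sigma> (D h p) = D h (\<sigma> p)"
proof -
  note c = comult_closed[OF h]
  note fc = linear_mapsD(1)[OF tensor_flip_linear[OF K H H] c]
  note cl = bilinear_mapsD(3)[OF \<Phi>_bilinear]
  have "\<sigma> (D h p) = \<tau> (\<Phi> R (D h p))" by (rule \<sigma>_eq[OF cl[OF c p]])
  also have "\<Phi> R (D h p) = \<Phi> (R \<otimes>\<^bsub>tensor K H H\<^esub> \<Delta> h) p" by (rule \<Phi>_mult[OF R_carrier c p, symmetric])
  also have "\<dots> = \<Phi> (tensor_flip K H H (\<Delta> h) \<otimes>\<^bsub>tensor K H H\<^esub> R) p"
    by (simp add: quasi_triangular_hopf_algebra.R_opposite[OF qt h])
  also have "\<dots> = \<Phi> (tensor_flip K H H (\<Delta> h)) (\<Phi> R p)" by (rule \<Phi>_mult[OF fc R_carrier p])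
  \<comment> \<open>\<open>\<tau>_\<Phi>\<close> flips the already flipped
    \<open>\<Delta> h\<close>, and the two flips cancel.\<close>
  also have "\<tau> \<dots> = D h (\<tau> (\<Phi> R p))"
    using \<tau>_\<Phi>[OF fc cl[OF R_carrier p]] by (simp add: tensor_flip_flip[OF K H H c])
  also have "\<tau> (\<Phi> R p) = \<sigma> p" by (rule \<sigma>_eq[OF p, symmetric])
  finally show ?thesis .
qed

section \<open>The product of \<open>A\<close> as a map of \<open>H\<close>-modules\<close>

private lemma \<mu>_linear: "\<mu> \<in> linear_maps K (tensor K A A) A"
  unfolding mult_map_def by (rule tensor_lift_linear[OF K A A A mA])

private lemma \<mu>_pure: "\<lbrakk>a \<in> carrier A; b \<in> carrier A\<rbrakk> \<Longrightarrow> \<mu> (pure_tensor K A A a b) = a \<otimes>\<^bsub>A\<^esub> b"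
  unfolding mult_map_def by (rule tensor_lift_pure[OF K A A A mA])

text \<open>This is the axiom \<open>act_prod\<close> extended linearly from
  \<open>a \<otimes> b\<close> to arbitrary \<open>q\<close>.\<close>

private lemma act_\<mu>:
  assumes h: "h \<in> carrier H" and q: "q \<in> carrier (tensor K A A)"
  shows "act h (\<mu> q) = \<mu> (D h q)"
proof (rule tensor_linear_eqI[OF A A A linear_maps_compose[OF bilinear_mapsD(1)[OF act h] \<mu>_linear]
      linear_maps_compose[OF \<mu>_linear bilinear_mapsD(1)[OF D_bilinear h]] _ q])
  fix a b assume ab: "a \<in> carrier A" "b \<in> carrier A"
  note p = bilinear_mapsD(3)[OF pAA ab]
  have b: "(\<lambda>g g'. act g a \<otimes>\<^bsub>A\<^esub> act g' b) \<in> bilinear_maps K H H A"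
    by (rule bilinear_maps_compose[OF mA bilinear_mapsD(2)[OF act ab(1)] bilinear_mapsD(2)[OF act ab(2)]])
  \<comment> \<open>The axiom lifts over \<open>\<Delta> h\<close> with \<open>a\<close> and
    \<open>b\<close> fixed. Both sides are linear in the element of \<open>H \<otimes> H\<close>, so
    they are compared at pure \<open>g \<otimes> g'\<close> in place of
    \<open>\<Delta> h\<close>.\<close>
  have "tensor_lift K A (\<lambda>g g'. act g a \<otimes>\<^bsub>A\<^esub> act g' b) (\<Delta> h) = \<mu> (D h (pure_tensor K A A a b))"
    by (rule tensor_linear_eqI[OF H H A tensor_lift_linear[OF K H H A b]
          linear_maps_compose[OF \<mu>_linear bilinear_mapsD(2)[OF \<Phi>_bilinear p]] _ comult_closed[OF h]])
       (simp add: tensor_lift_pure[OF K H H A b] \<Phi>_pure \<mu>_pure ab act_closed)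
  then show "act h (\<mu> (pure_tensor K A A a b)) = \<mu> (D h (pure_tensor K A A a b))"
    by (simp add: \<mu>_pure ab module_algebra.act_prod[OF ma h])
qed

section \<open>The two braidings on the threefold tensor power\<close>

private abbreviation "B1 \<equiv> braid1 K A \<sigma>"
private abbreviation "B2 \<equiv> braid2 K A \<sigma>"
private abbreviation "\<alpha> \<equiv> tensor_assoc K A A A"
private abbreviation "\<alpha>' \<equiv> tensor_assoc_inv K A A A"
private abbreviation "pure_A_AA \<equiv> pure_tensor K A (tensor K A A)"
private abbreviation "pure_AA_A \<equiv> pure_tensor K (tensor K A A) A"

private lemmas \<alpha>_linear = tensor_assoc_linear[OF K A A A]
private lemmas \<alpha>'_linear = tensor_assoc_inv_linear[OF K A A A]
private lemmas \<alpha>_pure = tensor_assoc_pure[OF K A A A]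
private lemmas \<alpha>'_pure = tensor_assoc_inv_pure[OF K A A A]
private lemmas \<alpha>_\<alpha>' = tensor_assoc_assoc_inv[OF K A A A]

private lemma B1_linear: "B1 \<in> linear_maps K (tensor3 K A) (tensor3 K A)"
  unfolding braid1_def by (rule tensor_map_linear[OF K AA A AA A \<sigma>_linear linear_maps_id])

private lemma B1_pure: "\<lbrakk>q \<in> carrier (tensor K A A); c \<in> carrier A\<rbrakk> \<Longrightarrow> B1 (pure_AA_A q c) = pure_AA_A (\<sigma> q) c"
  unfolding braid1_def by (simp add: tensor_map_pure[OF K AA A AA A \<sigma>_linear linear_maps_id])

private lemma B2_linear: "B2 \<in> linear_maps K (tensor3 K A) (tensor3 K A)"
  unfolding braid2_def comp_def
  by (rule linear_maps_compose[OF \<alpha>'_linear linear_maps_compose[OF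
        tensor_map_linear[OF K A AA A AA linear_maps_id \<sigma>_linear] \<alpha>_linear]])

text \<open>\<open>\<alpha>\<close> undoes \<open>\<alpha>'\<close>, so \<open>\<sigma>\<close>
  reaches \<open>q\<close> directly. Such elements are to \<open>B2\<close> what
  \<open>pure_AA_A q c\<close> is to \<open>B1\<close>.\<close>

private lemma B2_assoc_inv:
  "\<lbrakk>a \<in> carrier A; q \<in> carrier (tensor K A A)\<rbrakk> \<Longrightarrow> B2 (\<alpha>' (pure_A_AA a q)) = \<alpha>' (pure_A_AA a (\<sigma> q))"
  unfolding braid2_def
  by (simp add: \<alpha>_\<alpha>' bilinear_mapsD(3)[OF pA_AA] tensor_map_pure[OF K A AA A AA linear_maps_id \<sigma>_linear])

private lemma B2_pure:
  assumes "a \<in> carrier A" "b \<in> carrier A" "c \<in> carrier A"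
  shows "B2 (pure_AA_A (pure_tensor K A A a b) c) = \<alpha>' (pure_A_AA a (\<sigma> (pure_tensor K A A b c)))"
  using B2_assoc_inv[OF assms(1) bilinear_mapsD(3)[OF pAA assms(2,3)]] \<alpha>'_pure[OF assms] by simp

private lemma A_AA_closed: "\<lbrakk>a \<in> carrier A; q \<in> carrier (tensor K A A)\<rbrakk> \<Longrightarrow> \<alpha>' (pure_A_AA a q) \<in> carrier (tensor3 K A)"
  by (intro linear_mapsD(1)[OF \<alpha>'_linear] bilinear_mapsD(3)[OF pA_AA])

section \<open>The hexagon identities\<close>

text \<open>The braiding of \<open>A\<close> with the module \<open>A \<otimes> A\<close>: it
  carries \<open>a\<close> past \<open>q\<close> as a whole.\<close>

private definition \<Psi> where
  "\<Psi> a q = (\<Oplus>\<^bsub>tensor3 K A\<^esub>i\<in>I. pure_AA_A (D (t i) q) (act (s i) a))"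

text \<open>The braiding of \<open>A \<otimes> A\<close> with \<open>A\<close>, bracketed so that
  each summand is a pure tensor.\<close>

private definition \<Psi>' where
  "\<Psi>' q c = (\<Oplus>\<^bsub>tensor K A (tensor K A A)\<^esub>i\<in>I. pure_A_AA (act (t i) c) (D (s i) q))"

private lemma \<Psi>_bilinear: "\<Psi> \<in> bilinear_maps K A (tensor K A A) (tensor3 K A)"
  unfolding \<Psi>_def
  by (rule bilinear_maps_finsum[OF AAA I])
     (rule bilinear_maps_compose[OF bilinear_maps_swap[OF pAAA] bilinear_mapsD(1)[OF act]
        bilinear_mapsD(1)[OF D_bilinear]]; rule st; assumption)

private lemma \<Psi>'_bilinear: "\<Psi>' \<in> bilinear_maps K (tensor K A A) A (tensor K A (tensor K A A))"
  unfolding \<Psi>'_def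
  by (rule bilinear_maps_finsum[OF A_AA I])
     (rule bilinear_maps_compose[OF bilinear_maps_swap[OF pA_AA] bilinear_mapsD(1)[OF D_bilinear]
        bilinear_mapsD(1)[OF act]]; rule st; assumption)

private lemma \<Psi>_linear_image:
  assumes "module K X" "f \<in> linear_maps K (tensor3 K A) X" "a \<in> carrier A" "q \<in> carrier (tensor K A A)"
  shows "f (\<Psi> a q) = (\<Oplus>\<^bsub>X\<^esub>i\<in>I. f (pure_AA_A (D (t i) q) (act (s i) a)))"
  unfolding \<Psi>_def
  by (rule linear_map_finsum[OF AAA assms(1,2) I])
     (intro bilinear_mapsD(3)[OF pAAA] bilinear_mapsD(3)[OF D_bilinear] act_closed st assms)

private lemma \<Psi>'_linear_image:
  assumes "module K X" "f \<in> linear_maps K (tensor K A (tensor K A A)) X" "q \<in> carrier (tensor K A A)"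
    and "c \<in> carrier A"
  shows "f (\<Psi>' q c) = (\<Oplus>\<^bsub>X\<^esub>i\<in>I. f (pure_A_AA (act (t i) c) (D (s i) q)))"
  unfolding \<Psi>'_def
  by (rule linear_map_finsum[OF A_AA assms(1,2) I])
     (intro bilinear_mapsD(3)[OF pA_AA] bilinear_mapsD(3)[OF D_bilinear] act_closed st assms)

text \<open>The kernels of \<open>leg12\<close>, \<open>leg13\<close> and \<open>leg23\<close>, in
  this order.\<close>

private lemma leg_inner:
  shows "(\<lambda>x y. pure_tensor K (tensor K H H) H (pure_tensor K H H x y) \<one>\<^bsub>H\<^esub>) \<in> bilinear_maps K H H (tensor3 K H)"
    and "(\<lambda>x y. pure_tensor K (tensor K H H) H (pure_tensor K H H x \<one>\<^bsub>H\<^esub>) y) \<in> bilinear_maps K H H (tensor3 K H)"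
    and "(\<lambda>x y. pure_tensor K (tensor K H H) H (pure_tensor K H H \<one>\<^bsub>H\<^esub> x) y) \<in> bilinear_maps K H H (tensor3 K H)"
  by (rule linear_compose_bilinear[OF bilinear_mapsD(2)[OF pHHH one_H] pHH])
     (rule bilinear_maps_compose[OF pHHH bilinear_mapsD(2)[OF pHH one_H] linear_maps_ident],
      rule bilinear_maps_compose[OF pHHH bilinear_mapsD(1)[OF pHH one_H] linear_maps_ident])

private lemma linear_R:
  assumes X: "module K X" and b: "\<beta> \<in> bilinear_maps K H H X"
  shows "tensor_lift K X \<beta> R = (\<Oplus>\<^bsub>X\<^esub>i\<in>I. \<beta> (s i) (t i))"
proof -
  interpret X: module K X by (rule X)
  have "tensor_lift K X \<beta> R = (\<Oplus>\<^bsub>X\<^esub>i\<in>I. tensor_lift K X \<beta> (pure_tensor K H H (s i) (t i)))"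
    unfolding R
    by (rule linear_map_finsum[OF HH X tensor_lift_linear[OF K H H X b] I])
       (intro bilinear_mapsD(3)[OF pHH] st)
  also have "\<dots> = (\<Oplus>\<^bsub>X\<^esub>i\<in>I. \<beta> (s i) (t i))"
    by (rule X.M.finsum_cong'[OF refl])
       (auto simp: tensor_lift_pure[OF K H H X b] st intro!: bilinear_mapsD(3)[OF b])
  finally show ?thesis .
qed

text \<open>Each leg is a sum over \<open>I\<close> by \<open>linear_R\<close>, so the product is a
  double sum; \<open>i\<close> belongs to the left factor and \<open>j\<close> to the right
  one.\<close>

private lemma linear_legs_mult:
  assumes X: "module K X" and f: "f \<in> linear_maps K (tensor3 K H) X"
    and b: "\<beta> \<in> bilinear_maps K H H (tensor3 K H)" and g: "\<gamma> \<in> bilinear_maps K H H (tensor3 K H)"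
  shows "f (tensor_lift K (tensor3 K H) \<beta> R \<otimes>\<^bsub>tensor3 K H\<^esub> tensor_lift K (tensor3 K H) \<gamma> R)
    = (\<Oplus>\<^bsub>X\<^esub>j\<in>I. \<Oplus>\<^bsub>X\<^esub>i\<in>I. f (\<beta> (s i) (t i) \<otimes>\<^bsub>tensor3 K H\<^esub> \<gamma> (s j) (t j)))"
  unfolding linear_R[OF HHH b] linear_R[OF HHH g]
  by (rule bilinear_map_finsum[OF HHH HHH X linear_compose_bilinear[OF f HHH_mult_bilinear] I I])
     (intro bilinear_mapsD(3)[OF b] bilinear_mapsD(3)[OF g] st; assumption)+

text \<open>This is \<open>(\<Delta> \<otimes> id) R = R\<^sub>1\<^sub>3 R\<^sub>2\<^sub>3\<close>
  evaluated on \<open>a \<otimes> b \<otimes> c\<close>. The left side gives \<open>\<Psi>'\<close>;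
  on the right, \<open>R\<^sub>2\<^sub>3\<close> braids \<open>b\<close> past \<open>c\<close>, and
  \<open>R\<^sub>1\<^sub>3\<close> then braids \<open>a\<close> past the moved
  \<open>c\<close>.\<close>

private lemma hexagon_left:
  assumes q: "q \<in> carrier (tensor K A A)" and c: "c \<in> carrier A"
  shows "\<alpha> (B1 (B2 (pure_AA_A q c))) = \<Psi>' q c"
proof (rule tensor_bilinear_eqI[OF A A A A_AA _ \<Psi>'_bilinear _ q c])
  interpret X: module K "tensor K A (tensor K A A)" by (rule A_AA)
  note B = linear_maps_compose[OF \<alpha>_linear linear_maps_compose[OF B1_linear B2_linear]]
  show "(\<lambda>q c. \<alpha> (B1 (B2 (pure_AA_A q c)))) \<in> bilinear_maps K (tensor K A A) A (tensor K A (tensor K A A))"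
    by (rule linear_compose_bilinear[OF B pAAA])
  fix a b c assume abc: "a \<in> carrier A" "b \<in> carrier A" "c \<in> carrier A"
  note ab = bilinear_mapsD(3)[OF pAA abc(1,2)]
  \<comment> \<open>Lets \<open>w\<close> act on \<open>a \<otimes> b\<close> and \<open>z\<close>
    on \<open>c\<close>, then moves \<open>c\<close> to the front. The linear extension
    \<open>F\<close> carries identities in \<open>tensor3 K H\<close> over to
    \<open>A\<close>.\<close>
  define \<beta> where "\<beta> w z = pure_A_AA (act z c) (\<Phi> w (pure_tensor K A A a b))" for w z
  have \<beta>: "\<beta> \<in> bilinear_maps K (tensor K H H) H (tensor K A (tensor K A A))"
    unfolding \<beta>_def
    by (rule bilinear_maps_compose[OF bilinear_maps_swap[OF pA_AA] bilinear_mapsD(2)[OF \<Phi>_bilinear ab]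
          bilinear_mapsD(2)[OF act abc(3)]])
  define F where "F = tensor_lift K (tensor K A (tensor K A A)) \<beta>"
  have F: "F \<in> linear_maps K (tensor3 K H) (tensor K A (tensor K A A))"
    unfolding F_def by (rule tensor_lift_linear[OF K HH H A_AA \<beta>])
  have F_pure: "F (pure_tensor K (tensor K H H) H w z) = \<beta> w z"
    if "w \<in> carrier (tensor K H H)" "z \<in> carrier H" for w z
    unfolding F_def by (rule tensor_lift_pure[OF K HH H A_AA \<beta> that])
  have "\<Psi>' (pure_tensor K A A a b) c = F (tensor_map K (tensor K H H) H \<Delta> id R)"
  proof -
    have "F (tensor_map K (tensor K H H) H \<Delta> id R)
        = (\<Oplus>\<^bsub>tensor K A (tensor K A A)\<^esub>i\<in>I. F (tensor_map K (tensor K H H) H \<Delta> id (pure_tensor K H H (s i) (t i))))"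
      unfolding R
      by (rule linear_map_finsum[OF HH A_AA
            linear_maps_compose[OF F tensor_map_linear[OF K H H HH H comult linear_maps_id]] I])
         (intro bilinear_mapsD(3)[OF pHH] st)
    also have "\<dots> = \<Psi>' (pure_tensor K A A a b) c"
      unfolding \<Psi>'_def
      by (rule X.M.finsum_cong'[OF refl])
         (auto simp: tensor_map_pure[OF K H H HH H comult linear_maps_id] F_pure comult_closed st \<beta>_def
            intro!: bilinear_mapsD(3)[OF pA_AA] act_closed bilinear_mapsD(3)[OF D_bilinear] ab abc)
    finally show ?thesis ..
  qed
  also have "\<dots> = F (leg13 K H R \<otimes>\<^bsub>tensor3 K H\<^esub> leg23 K H R)"
    by (simp only: quasi_triangular_hopf_algebra.R_comult_left[OF qt])
  \<comment> \<open>The legs of the product are \<open>s i\<close>, \<open>s j\<close> and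
    \<open>t i\<close> times \<open>t j\<close>; \<open>act_mult\<close> splits the last into two
    successive actions on \<open>c\<close>.\<close>
  also have "\<dots> = (\<Oplus>\<^bsub>tensor K A (tensor K A A)\<^esub>j\<in>I. \<Oplus>\<^bsub>tensor K A (tensor K A A)\<^esub>i\<in>I.
      pure_A_AA (act (t i) (act (t j) c)) (pure_tensor K A A (act (s i) a) (act (s j) b)))"
    unfolding leg13_def leg23_def linear_legs_mult[OF A_AA F leg_inner(2,3)]
    by (intro X.M.finsum_cong'[OF refl] funcsetI X.M.finsum_closed)
       (simp_all add: HHH_mult_pure HH_mult_pure F_pure \<beta>_def \<Phi>_pure st one_H mult_one_H abc act_closed
          bilinear_mapsD(3)[OF pHH] bilinear_mapsD(3)[OF mH] bilinear_mapsD(3)[OF pA_AA]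
          bilinear_mapsD(3)[OF pAA] module_algebra.act_mult[OF ma])
  \<comment> \<open>For fixed \<open>j\<close> the sum over \<open>i\<close> is
    \<open>\<sigma>\<close> at \<open>a \<otimes> act (t j) c\<close>, that is,
    \<open>B1\<close>.\<close>
  also have "\<dots> = (\<Oplus>\<^bsub>tensor K A (tensor K A A)\<^esub>j\<in>I.
      \<alpha> (B1 (\<alpha>' (pure_A_AA a (pure_tensor K A A (act (t j) c) (act (s j) b))))))"
  proof (rule X.M.finsum_cong'[OF refl])
    fix j assume j: "j \<in> I"
    note cb = act_closed[OF st(2)[OF j] abc(3)] act_closed[OF st(1)[OF j] abc(2)]
    note f = linear_maps_compose[OF \<alpha>_linear bilinear_mapsD(2)[OF pAAA cb(2)]]
    have "\<alpha> (B1 (\<alpha>' (pure_A_AA a (pure_tensor K A A (act (t j) c) (act (s j) b)))))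
        = \<alpha> (pure_AA_A (\<sigma> (pure_tensor K A A a (act (t j) c))) (act (s j) b))"
      by (simp add: \<alpha>'_pure B1_pure abc cb bilinear_mapsD(3)[OF pAA])
    also have "\<dots> = (\<Oplus>\<^bsub>tensor K A (tensor K A A)\<^esub>i\<in>I.
        \<alpha> (pure_AA_A (pure_tensor K A A (act (t i) (act (t j) c)) (act (s i) a)) (act (s j) b)))"
      by (rule linear_\<sigma>_pure[OF A_AA f abc(1) cb(1)])
    also have "\<dots> = (\<Oplus>\<^bsub>tensor K A (tensor K A A)\<^esub>i\<in>I.
        pure_A_AA (act (t i) (act (t j) c)) (pure_tensor K A A (act (s i) a) (act (s j) b)))"
      by (intro X.M.finsum_cong'[OF refl] funcsetI)
         (simp_all add: \<alpha>_pure st abc cb act_closed bilinear_mapsD(3)[OF pA_AA] bilinear_mapsD(3)[OF pAA])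
    finally show "(\<Oplus>\<^bsub>tensor K A (tensor K A A)\<^esub>i\<in>I.
        pure_A_AA (act (t i) (act (t j) c)) (pure_tensor K A A (act (s i) a) (act (s j) b)))
      = \<alpha> (B1 (\<alpha>' (pure_A_AA a (pure_tensor K A A (act (t j) c) (act (s j) b)))))" ..
  next
    show "(\<lambda>j. \<alpha> (B1 (\<alpha>' (pure_A_AA a (pure_tensor K A A (act (t j) c) (act (s j) b))))))
        \<in> I \<rightarrow> carrier (tensor K A (tensor K A A))"
      by (auto intro!: linear_mapsD(1)[OF \<alpha>_linear] linear_mapsD(1)[OF B1_linear] A_AA_closed
          bilinear_mapsD(3)[OF pAA] act_closed st abc)
  qed
  \<comment> \<open>The remaining sum over \<open>j\<close> is \<open>\<sigma>\<close> at
    \<open>b \<otimes> c\<close>, that is, \<open>B2\<close>.\<close>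
  also have "\<dots> = \<alpha> (B1 (\<alpha>' (pure_A_AA a (\<sigma> (pure_tensor K A A b c)))))"
    by (rule linear_\<sigma>_pure[OF A_AA linear_maps_compose[OF \<alpha>_linear linear_maps_compose[OF B1_linear
            linear_maps_compose[OF \<alpha>'_linear bilinear_mapsD(1)[OF pA_AA abc(1)]]]] abc(2,3), symmetric])
  also have "\<dots> = \<alpha> (B1 (B2 (pure_AA_A (pure_tensor K A A a b) c)))"
    by (simp only: B2_pure[OF abc])
  finally show "\<alpha> (B1 (B2 (pure_AA_A (pure_tensor K A A a b) c))) = \<Psi>' (pure_tensor K A A a b) c" ..
qed

text \<open>The same evaluation for \<open>(id \<otimes> \<Delta>) R = R\<^sub>1\<^sub>3
  R\<^sub>1\<^sub>2\<close>: here \<open>R\<^sub>1\<^sub>2\<close> braids \<open>a\<close> past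
  \<open>b\<close>, and \<open>R\<^sub>1\<^sub>3\<close> then braids the moved \<open>a\<close> past
  \<open>c\<close>.\<close>

private lemma hexagon_right:
  assumes a: "a \<in> carrier A" and q: "q \<in> carrier (tensor K A A)"
  shows "B2 (B1 (\<alpha>' (pure_A_AA a q))) = \<Psi> a q"
\<comment> \<open>This rule decomposes the first argument, so \<open>a\<close> and \<open>q\<close>
  are swapped to make \<open>q\<close> come first.\<close>
proof (rule tensor_bilinear_eqI[OF A A A AAA _ bilinear_maps_swap[OF \<Psi>_bilinear] _ q a])
  interpret X: module K "tensor3 K A" by (rule AAA)
  note B = linear_maps_compose[OF B2_linear linear_maps_compose[OF B1_linear \<alpha>'_linear]]
  show "(\<lambda>q a. B2 (B1 (\<alpha>' (pure_A_AA a q)))) \<in> bilinear_maps K (tensor K A A) A (tensor3 K A)"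
    by (rule linear_compose_bilinear[OF B bilinear_maps_swap[OF pA_AA]])
  fix b c a assume bca: "b \<in> carrier A" "c \<in> carrier A" "a \<in> carrier A"
  note bc = bilinear_mapsD(3)[OF pAA bca(1,2)]
  define \<beta> where "\<beta> x w = pure_AA_A (\<Phi> w (pure_tensor K A A b c)) (act x a)" for x w
  have \<beta>: "\<beta> \<in> bilinear_maps K H (tensor K H H) (tensor3 K A)"
    unfolding \<beta>_def
    by (rule bilinear_maps_compose[OF bilinear_maps_swap[OF pAAA] bilinear_mapsD(2)[OF act bca(3)]
          bilinear_mapsD(2)[OF \<Phi>_bilinear bc]])
  define F where "F = tensor_lift K (tensor3 K A) \<beta>"
  have F: "F \<in> linear_maps K (tensor K H (tensor K H H)) (tensor3 K A)"
    unfolding F_def by (rule tensor_lift_linear[OF K H HH AAA \<beta>])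
  have F_pure: "F (pure_tensor K H (tensor K H H) x w) = \<beta> x w"
    if "x \<in> carrier H" "w \<in> carrier (tensor K H H)" for x w
    unfolding F_def by (rule tensor_lift_pure[OF K H HH AAA \<beta> that])
  have "\<Psi> a (pure_tensor K A A b c) = F (tensor_map K H (tensor K H H) id \<Delta> R)"
  proof -
    have "F (tensor_map K H (tensor K H H) id \<Delta> R)
        = (\<Oplus>\<^bsub>tensor3 K A\<^esub>i\<in>I. F (tensor_map K H (tensor K H H) id \<Delta> (pure_tensor K H H (s i) (t i))))"
      unfolding R
      by (rule linear_map_finsum[OF HH AAA
            linear_maps_compose[OF F tensor_map_linear[OF K H H H HH linear_maps_id comult]] I])
         (intro bilinear_mapsD(3)[OF pHH] st)
    also have "\<dots> = \<Psi> a (pure_tensor K A A b c)"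
      unfolding \<Psi>_def
      by (rule X.M.finsum_cong'[OF refl])
         (auto simp: tensor_map_pure[OF K H H H HH linear_maps_id comult] F_pure comult_closed st \<beta>_def
            intro!: bilinear_mapsD(3)[OF pAAA] act_closed bilinear_mapsD(3)[OF D_bilinear] bc bca)
    finally show ?thesis ..
  qed
  \<comment> \<open>\<open>F\<close> is defined on \<open>H \<otimes> (H \<otimes> H)\<close>, so
    the rebracketing stays and is composed with \<open>F\<close> when the legs are expanded.\<close>
  also have "\<dots> = F (tensor_assoc K H H H (leg13 K H R \<otimes>\<^bsub>tensor3 K H\<^esub> leg12 K H R))"
    by (simp only: quasi_triangular_hopf_algebra.R_comult_right[OF qt])
  also have "\<dots> = (\<Oplus>\<^bsub>tensor3 K A\<^esub>j\<in>I. \<Oplus>\<^bsub>tensor3 K A\<^esub>i\<in>I.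
      pure_AA_A (pure_tensor K A A (act (t j) b) (act (t i) c)) (act (s i) (act (s j) a)))"
    unfolding leg13_def leg12_def
      linear_legs_mult[OF AAA linear_maps_compose[OF F tensor_assoc_linear[OF K H H H]] leg_inner(2,1)]
    by (intro X.M.finsum_cong'[OF refl] funcsetI X.M.finsum_closed)
       (simp_all add: HHH_mult_pure HH_mult_pure tensor_assoc_pure[OF K H H H] F_pure \<beta>_def \<Phi>_pure
          st one_H mult_one_H bca act_closed
          bilinear_mapsD(3)[OF pHH] bilinear_mapsD(3)[OF mH] bilinear_mapsD(3)[OF pAAA]
          bilinear_mapsD(3)[OF pAA] module_algebra.act_mult[OF ma])
  \<comment> \<open>The sum over \<open>i\<close> is \<open>\<sigma>\<close> at
    \<open>act (s j) a \<otimes> c\<close>, giving \<open>B2\<close>; the sum over \<open>j\<close>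
    then becomes \<open>\<sigma>\<close> at \<open>a \<otimes> b\<close>, giving
    \<open>B1\<close>.\<close>
  also have "\<dots> = (\<Oplus>\<^bsub>tensor3 K A\<^esub>j\<in>I.
      B2 (pure_AA_A (pure_tensor K A A (act (t j) b) (act (s j) a)) c))"
  proof (rule X.M.finsum_cong'[OF refl])
    fix j assume j: "j \<in> I"
    note ba = act_closed[OF st(2)[OF j] bca(1)] act_closed[OF st(1)[OF j] bca(3)]
    note f = linear_maps_compose[OF \<alpha>'_linear bilinear_mapsD(1)[OF pA_AA ba(1)]]
    have "B2 (pure_AA_A (pure_tensor K A A (act (t j) b) (act (s j) a)) c)
        = \<alpha>' (pure_A_AA (act (t j) b) (\<sigma> (pure_tensor K A A (act (s j) a) c)))"
      by (rule B2_pure[OF ba bca(2)])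
    also have "\<dots> = (\<Oplus>\<^bsub>tensor3 K A\<^esub>i\<in>I.
        \<alpha>' (pure_A_AA (act (t j) b) (pure_tensor K A A (act (t i) c) (act (s i) (act (s j) a)))))"
      by (rule linear_\<sigma>_pure[OF AAA f ba(2) bca(2)])
    also have "\<dots> = (\<Oplus>\<^bsub>tensor3 K A\<^esub>i\<in>I.
        pure_AA_A (pure_tensor K A A (act (t j) b) (act (t i) c)) (act (s i) (act (s j) a)))"
      by (intro X.M.finsum_cong'[OF refl] funcsetI)
         (simp_all add: \<alpha>'_pure st bca ba act_closed bilinear_mapsD(3)[OF pAAA] bilinear_mapsD(3)[OF pAA])
    finally show "(\<Oplus>\<^bsub>tensor3 K A\<^esub>i\<in>I.
        pure_AA_A (pure_tensor K A A (act (t j) b) (act (t i) c)) (act (s i) (act (s j) a)))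
      = B2 (pure_AA_A (pure_tensor K A A (act (t j) b) (act (s j) a)) c)" ..
  next
    show "(\<lambda>j. B2 (pure_AA_A (pure_tensor K A A (act (t j) b) (act (s j) a)) c)) \<in> I \<rightarrow> carrier (tensor3 K A)"
      by (auto intro!: linear_mapsD(1)[OF B2_linear] bilinear_mapsD(3)[OF pAAA]
          bilinear_mapsD(3)[OF pAA] act_closed st bca)
  qed
  also have "\<dots> = B2 (pure_AA_A (\<sigma> (pure_tensor K A A a b)) c)"
    by (rule linear_\<sigma>_pure[OF AAA linear_maps_compose[OF B2_linear bilinear_mapsD(2)[OF pAAA bca(2)]]
          bca(3,1), symmetric])
  also have "\<dots> = B2 (B1 (\<alpha>' (pure_A_AA a (pure_tensor K A A b c))))"
    by (simp add: \<alpha>'_pure B1_pure bca bilinear_mapsD(3)[OF pAA])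
  finally show "B2 (B1 (\<alpha>' (pure_A_AA a (pure_tensor K A A b c)))) = \<Psi> a (pure_tensor K A A b c)" ..
qed

section \<open>The Yang-Baxter equation and invertibility\<close>

text \<open>Naturality of the braiding in \<open>q\<close>: each \<open>t i\<close> acts on
  \<open>q\<close> through \<open>D\<close>, and \<open>\<sigma>_D\<close> moves
  \<open>\<sigma>\<close> past it.\<close>

private lemma B1_\<Psi>:
  assumes a: "a \<in> carrier A" and q: "q \<in> carrier (tensor K A A)"
  shows "B1 (\<Psi> a q) = \<Psi> a (\<sigma> q)"
proof -
  interpret X: module K "tensor3 K A" by (rule AAA)
  note \<sigma>q = linear_mapsD(1)[OF \<sigma>_linear q]
  show ?thesis
    unfolding \<Psi>_linear_image[OF AAA B1_linear a q]
    unfolding \<Psi>_def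
    by (intro X.M.finsum_cong'[OF refl] funcsetI)
       (simp_all add: B1_pure \<sigma>_D st a q \<sigma>q act_closed bilinear_mapsD(3)[OF D_bilinear]
          bilinear_mapsD(3)[OF pAAA])
qed

text \<open>At \<open>\<alpha>' (pure_A_AA a q)\<close> the left side is
  \<open>B1 (\<Psi> a q)\<close>. On the right, \<open>B2\<close> first replaces \<open>q\<close> by
  \<open>\<sigma> q\<close>, which leads to \<open>\<Psi> a (\<sigma> q)\<close>. The two agree by
  \<open>B1_\<Psi>\<close>.\<close>

private lemma yang_baxter:
  assumes "x \<in> carrier (tensor3 K A)"
  shows "B1 (B2 (B1 x)) = B2 (B1 (B2 x))"
  by (rule tensor3_linear_eqI'[OF K A A A AAA
        linear_maps_compose[OF B1_linear linear_maps_compose[OF B2_linear B1_linear]]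
        linear_maps_compose[OF B2_linear linear_maps_compose[OF B1_linear B2_linear]] _ assms])
     (simp add: hexagon_right B1_\<Psi> B2_assoc_inv linear_mapsD(1)[OF \<sigma>_linear])

private lemma \<sigma>_bij: "bij_betw \<sigma> (carrier (tensor K A A)) (carrier (tensor K A A))"
proof -
  obtain R' where R': "R' \<in> carrier (tensor K H H)"
    "R' \<otimes>\<^bsub>tensor K H H\<^esub> R = \<one>\<^bsub>tensor K H H\<^esub>" "R \<otimes>\<^bsub>tensor K H H\<^esub> R' = \<one>\<^bsub>tensor K H H\<^esub>"
    using quasi_triangular_hopf_algebra.R_invertible[OF qt] by (auto simp: Units_def)
  note \<tau>c = linear_mapsD(1)[OF \<tau>_linear] and \<Phi>c = bilinear_mapsD(3)[OF \<Phi>_bilinear]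
  show ?thesis
  \<comment> \<open>Since \<open>\<sigma>\<close> is \<open>\<tau>\<close> after
    \<open>\<Phi> R\<close> and \<open>\<tau>\<close> is its own inverse, the inverse is
    \<open>\<Phi> R'\<close> after \<open>\<tau>\<close>. The two checks use \<open>R' R = 1\<close>
    and \<open>R R' = 1\<close> respectively.\<close>
  proof (rule bij_betw_byWitness[where f' = "\<lambda>q. \<Phi> R' (\<tau> q)"])
    show "\<forall>p\<in>carrier (tensor K A A). \<Phi> R' (\<tau> (\<sigma> p)) = p"
      by (simp add: \<sigma>_eq tensor_flip_flip[OF K A A] \<Phi>c R_carrier R' \<Phi>_one flip: \<Phi>_mult)
    show "\<forall>q\<in>carrier (tensor K A A). \<sigma> (\<Phi> R' (\<tau> q)) = q"
      by (simp add: \<sigma>_eq tensor_flip_flip[OF K A A] \<tau>c \<Phi>c R_carrier R' \<Phi>_one flip: \<Phi>_mult)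
  qed (auto intro: \<Phi>c[OF R'(1)] \<tau>c linear_mapsD(1)[OF \<sigma>_linear])
qed

section \<open>Compatibility with the product\<close>

text \<open>At \<open>pure_AA_A q c\<close>, \<open>hexagon_left\<close> turns the right side into a
  sum in which \<open>\<mu>\<close> meets \<open>D (s i) q\<close>. By \<open>act_\<mu>\<close> this
  is \<open>s i\<close> acting on \<open>\<mu> q\<close>, and the sum is \<open>\<sigma>\<close> at
  \<open>\<mu> q \<otimes> c\<close>.\<close>

private lemma mult_left:
  assumes "x \<in> carrier (tensor3 K A)"
  shows "\<sigma> (tensor_map K A A \<mu> id x) = tensor_map K A A id \<mu> (\<alpha> (B1 (B2 x)))"
proof (rule tensor_linear_eqI[OF AA A AA _ _ _ assms])
  interpret X: module K "tensor K A A" by (rule AA)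
  note l = tensor_map_linear[OF K AA A A A \<mu>_linear linear_maps_id]
    and r = tensor_map_linear[OF K A AA A A linear_maps_id \<mu>_linear]
  show "(\<lambda>x. \<sigma> (tensor_map K A A \<mu> id x)) \<in> linear_maps K (tensor3 K A) (tensor K A A)"
    by (rule linear_maps_compose[OF \<sigma>_linear l])
  show "(\<lambda>x. tensor_map K A A id \<mu> (\<alpha> (B1 (B2 x)))) \<in> linear_maps K (tensor3 K A) (tensor K A A)"
    by (rule linear_maps_compose[OF r linear_maps_compose[OF \<alpha>_linear
            linear_maps_compose[OF B1_linear B2_linear]]])
  fix q c assume q: "q \<in> carrier (tensor K A A)" and c: "c \<in> carrier A"
  note \<mu>q = linear_mapsD(1)[OF \<mu>_linear q]
  have \<mu>_id: "tensor_map K A A \<mu> id (pure_AA_A q c) = pure_tensor K A A (\<mu> q) c"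
    by (simp add: tensor_map_pure[OF K AA A A A \<mu>_linear linear_maps_id q c])
  show "\<sigma> (tensor_map K A A \<mu> id (pure_AA_A q c)) = tensor_map K A A id \<mu> (\<alpha> (B1 (B2 (pure_AA_A q c))))"
    unfolding hexagon_left[OF q c] \<Psi>'_linear_image[OF AA r q c]
      \<mu>_id \<sigma>_pure[OF \<mu>q c]
    by (intro X.M.finsum_cong'[OF refl] funcsetI)
       (simp_all add: tensor_map_pure[OF K A AA A A linear_maps_id \<mu>_linear] act_\<mu> st c q act_closed
          bilinear_mapsD(3)[OF D_bilinear] bilinear_mapsD(3)[OF pAA] linear_mapsD(1)[OF \<mu>_linear])
qed

text \<open>The mirror argument, tested on \<open>\<alpha>' (pure_A_AA a q)\<close>:
  \<open>hexagon_right\<close> makes \<open>\<mu>\<close> meet \<open>D (t i) q\<close>.\<close>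

private lemma mult_right:
  assumes "x \<in> carrier (tensor3 K A)"
  shows "\<sigma> (tensor_map K A A id \<mu> (\<alpha> x)) = tensor_map K A A \<mu> id (B2 (B1 x))"
proof (rule tensor3_linear_eqI'[OF K A A A AA _ _ _ assms])
  interpret X: module K "tensor K A A" by (rule AA)
  note l = tensor_map_linear[OF K AA A A A \<mu>_linear linear_maps_id]
    and r = tensor_map_linear[OF K A AA A A linear_maps_id \<mu>_linear]
  show "(\<lambda>x. \<sigma> (tensor_map K A A id \<mu> (\<alpha> x))) \<in> linear_maps K (tensor3 K A) (tensor K A A)"
    by (rule linear_maps_compose[OF \<sigma>_linear linear_maps_compose[OF r \<alpha>_linear]])
  show "(\<lambda>x. tensor_map K A A \<mu> id (B2 (B1 x))) \<in> linear_maps K (tensor3 K A) (tensor K A A)"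
    by (rule linear_maps_compose[OF l linear_maps_compose[OF B2_linear B1_linear]])
  fix a q assume a: "a \<in> carrier A" and q: "q \<in> carrier (tensor K A A)"
  note \<mu>q = linear_mapsD(1)[OF \<mu>_linear q]
  have id_\<mu>: "tensor_map K A A id \<mu> (pure_A_AA a q) = pure_tensor K A A a (\<mu> q)"
    by (simp add: tensor_map_pure[OF K A AA A A linear_maps_id \<mu>_linear a q])
  show "\<sigma> (tensor_map K A A id \<mu> (\<alpha> (\<alpha>' (pure_A_AA a q)))) = tensor_map K A A \<mu> id (B2 (B1 (\<alpha>' (pure_A_AA a q))))"
    unfolding hexagon_right[OF a q] \<Psi>_linear_image[OF AA l a q] \<alpha>_\<alpha>'[OF bilinear_mapsD(3)[OF pA_AA a q]]
      id_\<mu> \<sigma>_pure[OF a \<mu>q]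
    by (intro X.M.finsum_cong'[OF refl] funcsetI)
       (simp_all add: tensor_map_pure[OF K AA A A A \<mu>_linear linear_maps_id] act_\<mu> st a q act_closed
          bilinear_mapsD(3)[OF D_bilinear] bilinear_mapsD(3)[OF pAA] linear_mapsD(1)[OF \<mu>_linear])
qed

section \<open>Compatibility with the unit\<close>

private lemma counit_closed: "h \<in> carrier H \<Longrightarrow> \<epsilon> h \<in> carrier K"
  using ring_hom_closed[OF hopf_algebra.counit_hom[OF H_hopf]] .

text \<open>
  Since \<open>h\<close> acts on \<open>1\<close> by \<open>\<epsilon> h\<close>, we have \<open>\<sigma> (1 \<otimes> c) = e c \<otimes> 1\<close> for a linear \<open>e\<close>. The hexagon at
  \<open>1 \<otimes> 1 \<otimes> c\<close> gives \<open>e (e c) \<otimes> 1 = e c \<otimes> 1\<close>, that is \<open>\<sigma> (1 \<otimes> e c) = \<sigma> (1 \<otimes> c)\<close>,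
  and \<open>\<sigma>\<close> is injective.
\<close>

private lemma one_left:
  assumes c: "c \<in> carrier A"
  shows "\<sigma> (pure_tensor K A A \<one>\<^bsub>A\<^esub> c) = pure_tensor K A A c \<one>\<^bsub>A\<^esub>"
proof -
  interpret X: module K "tensor K A A" by (rule AA)
  interpret A: module K A by (rule A)
  define e where "e c = (\<Oplus>\<^bsub>A\<^esub>i\<in>I. \<epsilon> (s i) \<odot>\<^bsub>A\<^esub> act (t i) c)" for c
  have e_closed: "e x \<in> carrier A" if "x \<in> carrier A" for x
    unfolding e_def using that by (auto intro!: A.M.finsum_closed counit_closed act_closed st)
  have \<sigma>1: "\<sigma> (pure_tensor K A A \<one>\<^bsub>A\<^esub> x) = pure_tensor K A A (e x) \<one>\<^bsub>A\<^esub>" if x: "x \<in> carrier A" for x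
  proof -
    have "pure_tensor K A A (e x) \<one>\<^bsub>A\<^esub>
        = (\<Oplus>\<^bsub>tensor K A A\<^esub>i\<in>I. pure_tensor K A A (\<epsilon> (s i) \<odot>\<^bsub>A\<^esub> act (t i) x) \<one>\<^bsub>A\<^esub>)"
      unfolding e_def
      by (rule linear_map_finsum[OF A AA bilinear_mapsD(2)[OF pAA one_A] I])
         (auto intro: counit_closed act_closed st x)
    also have "\<dots> = \<sigma> (pure_tensor K A A \<one>\<^bsub>A\<^esub> x)"
      unfolding \<sigma>_pure[OF one_A x]
      by (intro X.M.finsum_cong'[OF refl] funcsetI)
         (simp_all add: st x one_A act_closed counit_closed module_algebra.act_unit[OF ma]
            bilinear_mapsD(3)[OF pAA] linear_mapsD(3)[OF bilinear_mapsD(1)[OF pAA]]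
            linear_mapsD(3)[OF bilinear_mapsD(2)[OF pAA]])
    finally show ?thesis ..
  qed
  note ec = e_closed[OF c] and eec = e_closed[OF e_closed[OF c]]
  note p = bilinear_mapsD(3)[OF pAA]
  have "\<sigma> (pure_tensor K A A \<one>\<^bsub>A\<^esub> c) = \<sigma> (tensor_map K A A \<mu> id (pure_AA_A (pure_tensor K A A \<one>\<^bsub>A\<^esub> \<one>\<^bsub>A\<^esub>) c))"
    by (simp add: tensor_map_pure[OF K AA A A A \<mu>_linear linear_maps_id] p one_A c \<mu>_pure mult_one_A)
  also have "\<dots> = tensor_map K A A id \<mu> (\<alpha> (B1 (B2 (pure_AA_A (pure_tensor K A A \<one>\<^bsub>A\<^esub> \<one>\<^bsub>A\<^esub>) c))))"
    by (rule mult_left[OF bilinear_mapsD(3)[OF pAAA p[OF one_A one_A] c]])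
  also have "\<dots> = pure_tensor K A A (e (e c)) \<one>\<^bsub>A\<^esub>"
    by (simp add: B2_pure \<alpha>'_pure B1_pure \<alpha>_pure \<sigma>1 one_A c ec eec p \<mu>_pure mult_one_A
        tensor_map_pure[OF K A AA A A linear_maps_id \<mu>_linear])
  also have "\<dots> = \<sigma> (pure_tensor K A A \<one>\<^bsub>A\<^esub> (e c))" by (rule \<sigma>1[OF ec, symmetric])
  finally have "pure_tensor K A A \<one>\<^bsub>A\<^esub> c = pure_tensor K A A \<one>\<^bsub>A\<^esub> (e c)"
    using bij_betw_imp_inj_on[OF \<sigma>_bij] p one_A c ec by (auto dest: inj_onD)
  \<comment> \<open>Applying \<open>\<tau>\<close> to both sides moves the unit to the second
    factor; the result remains an equation of tensors and is not cancelled to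
    \<open>c = e c\<close>.\<close>
  then have "pure_tensor K A A c \<one>\<^bsub>A\<^esub> = pure_tensor K A A (e c) \<one>\<^bsub>A\<^esub>"
    using \<tau>_pure one_A c ec by metis
  then show ?thesis by (simp add: \<sigma>1 c)
qed

text \<open>Mirror image of \<open>one_left\<close>: \<open>e\<close> is now the action of the sum
  of all \<open>\<epsilon> (t i) \<odot> s i\<close>. By \<open>mult_right\<close> at
  \<open>c \<otimes> 1 \<otimes> 1\<close>, \<open>\<sigma>\<close> takes the same value at
  \<open>c \<otimes> 1\<close> and \<open>e c \<otimes> 1\<close>, and injectivity identifies
  these.\<close>

private lemma one_right:
  assumes c: "c \<in> carrier A"
  shows "\<sigma> (pure_tensor K A A c \<one>\<^bsub>A\<^esub>) = pure_tensor K A A \<one>\<^bsub>A\<^esub> c"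
proof -
  interpret X: module K "tensor K A A" by (rule AA)
  interpret A: module K A by (rule A)
  define e where "e c = (\<Oplus>\<^bsub>A\<^esub>i\<in>I. \<epsilon> (t i) \<odot>\<^bsub>A\<^esub> act (s i) c)" for c
  have e_closed: "e x \<in> carrier A" if "x \<in> carrier A" for x
    unfolding e_def using that by (auto intro!: A.M.finsum_closed counit_closed act_closed st)
  have \<sigma>1: "\<sigma> (pure_tensor K A A x \<one>\<^bsub>A\<^esub>) = pure_tensor K A A \<one>\<^bsub>A\<^esub> (e x)" if x: "x \<in> carrier A" for x
  proof -
    have "pure_tensor K A A \<one>\<^bsub>A\<^esub> (e x)
        = (\<Oplus>\<^bsub>tensor K A A\<^esub>i\<in>I. pure_tensor K A A \<one>\<^bsub>A\<^esub> (\<epsilon> (t i) \<odot>\<^bsub>A\<^esub> act (s i) x))"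
      unfolding e_def
      by (rule linear_map_finsum[OF A AA bilinear_mapsD(1)[OF pAA one_A] I])
         (auto intro: counit_closed act_closed st x)
    also have "\<dots> = \<sigma> (pure_tensor K A A x \<one>\<^bsub>A\<^esub>)"
      unfolding \<sigma>_pure[OF x one_A]
      by (intro X.M.finsum_cong'[OF refl] funcsetI)
         (simp_all add: st x one_A act_closed counit_closed module_algebra.act_unit[OF ma]
            bilinear_mapsD(3)[OF pAA] linear_mapsD(3)[OF bilinear_mapsD(1)[OF pAA]]
            linear_mapsD(3)[OF bilinear_mapsD(2)[OF pAA]])
    finally show ?thesis ..
  qed
  note ec = e_closed[OF c] and eec = e_closed[OF e_closed[OF c]]
  note p = bilinear_mapsD(3)[OF pAA]
  let ?x = "pure_AA_A (pure_tensor K A A c \<one>\<^bsub>A\<^esub>) \<one>\<^bsub>A\<^esub>"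
  have "\<sigma> (pure_tensor K A A c \<one>\<^bsub>A\<^esub>) = \<sigma> (tensor_map K A A id \<mu> (\<alpha> ?x))"
    by (simp add: \<alpha>_pure tensor_map_pure[OF K A AA A A linear_maps_id \<mu>_linear] p one_A c \<mu>_pure mult_one_A)
  also have "\<dots> = tensor_map K A A \<mu> id (B2 (B1 ?x))"
    by (rule mult_right[OF bilinear_mapsD(3)[OF pAAA p[OF c one_A] one_A]])
  also have "\<dots> = pure_tensor K A A \<one>\<^bsub>A\<^esub> (e (e c))"
    by (simp add: B2_pure \<alpha>'_pure B1_pure \<sigma>1 one_A c ec eec p \<mu>_pure mult_one_A
        tensor_map_pure[OF K AA A A A \<mu>_linear linear_maps_id])
  also have "\<dots> = \<sigma> (pure_tensor K A A (e c) \<one>\<^bsub>A\<^esub>)" by (rule \<sigma>1[OF ec, symmetric])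
  finally have "pure_tensor K A A c \<one>\<^bsub>A\<^esub> = pure_tensor K A A (e c) \<one>\<^bsub>A\<^esub>"
    using bij_betw_imp_inj_on[OF \<sigma>_bij] p one_A c ec by (auto dest: inj_onD)
  then have "pure_tensor K A A \<one>\<^bsub>A\<^esub> c = pure_tensor K A A \<one>\<^bsub>A\<^esub> (e c)"
    using \<tau>_pure one_A c ec by metis
  then show ?thesis by (simp add: \<sigma>1 c)
qed

lemma R_matrix_braiding_braided_algebra: "braided_algebra K A \<sigma>"
  by (intro braided_algebra.intro A_alg braiding.intro kvector_space.intro K A braiding_axioms.intro
      braided_algebra_axioms.intro \<sigma>_linear \<sigma>_bij yang_baxter mult_left mult_right one_left one_right)

end

theorem theorem2p7:
  fixes K :: "('k, 'r) ring_scheme"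
    and H :: "('k, 'h, 'm) module_scheme"
    and A :: "('k, 'a, 'n) module_scheme"
    and s t :: "'i \<Rightarrow> 'h"
  assumes "char0_field K"
    and "quasi_triangular_hopf_algebra K H \<Delta> \<epsilon> S R"
    and "finite I" and "s \<in> I \<rightarrow> carrier H" and "t \<in> I \<rightarrow> carrier H"
    and "R = (\<Oplus>\<^bsub>tensor K H H\<^esub>i\<in>I. pure_tensor K H H (s i) (t i))"
    and "module_algebra K H \<Delta> \<epsilon> S A act"
  shows "braided_algebra K A
    (tensor_lift K (tensor K A A)
      (\<lambda>a b. \<Oplus>\<^bsub>tensor K A A\<^esub>i\<in>I. pure_tensor K A A (act (t i) b) (act (s i) a)))"
  using R_matrix_braiding_braided_algebra[OF assms(2,7,3-6)]
  unfolding R_matrix_braiding_def .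

end
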